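(* Let $J:\mathbb{R}^N\setminus\{0\}\to[0,\infty)$ be radially symmetric, positive near the origin, and such that $\int_{\mathbb{R}^N}J(z)\min\{|z|^2,1\}\,dz<\infty$. Let $1<p<\infty$ and $\bar p=\max\{p,2\}$. Assume that for some $0<\alpha\le2$ there exist $c_0,R>0$ with $J(z)\ge c_0|z|^{-N-\alpha}$ for $|z|\ge R$. Given $u_0\in L^1(\mathbb{R}^N)\cap L^{\bar p}(\mathbb{R}^N)$, let $u$ be the associated solution of $$\partial_tu+\mathcal{L}u=0\ \text{ in }\mathbb{R}^N\times(0,\infty),\qquad u(\cdot,0)=u_0 .$$ Then there exists $t_0>0$ (which may depend on $u_0$) such that, for every $t>t_0$ and every $1\le q<p$, $$\|u(t)\|_p\le c\,t^{-\frac N\alpha\left(\frac1q-\frac1p\right)}\|u_0\|_q,$$ where $c>0$ is a constant independent of $t$ and $u_0$ (it may depend on $N,J,\alpha,p,q$).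
   Context: $N\ge1$ is an integer and $\|\cdot\|_p$ is the norm of $L^p(\mathbb{R}^N)$. The operator is $\mathcal{L}f(x)=\mathrm{P.V.}\int_{\mathbb{R}^N}(f(x)-f(y))J(x-y)\,dy$, with Dirichlet form $\mathcal{E}(f,g)=\frac12\iint(f(x)-f(y))(g(x)-g(y))J(x-y)\,dx\,dy$ and multiplier $m(\xi)=\int_{\mathbb{R}^N}(1-\cos(z\cdot\xi))J(z)\,dz$. For $u_0\in L^1(\mathbb{R}^N)\cap L^2(\mathbb{R}^N)$ "the solution" is the (unique) weak solution, given by $u(t)=u_0*\mu_t$, where $\mu_t$ is the probability measure on $\mathbb{R}^N$ with $\widehat{\mu_t}(\xi)=e^{-m(\xi)t}$. *)

theory Defs
  imports "HOL-Probability.Probability"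
begin

text \<open>
  Elements of \<open>L\<^sup>p\<close> are given by Borel representatives. The exponents used are real numbers
  \<open>p \<ge> 1\<close>.  Outside \<open>Lp p\<close> the value of \<open>Lp_norm p\<close> is meaningless.
\<close>

definition Lp :: "real \<Rightarrow> ('a::euclidean_space \<Rightarrow> real) set" where
  "Lp p = {f. f \<in> borel_measurable lborel \<and> integrable lborel (\<lambda>x. \<bar>f x\<bar> powr p)}"

definition Lp_norm :: "real \<Rightarrow> ('a::euclidean_space \<Rightarrow> real) \<Rightarrow> real" where
  "Lp_norm p f = (LINT x|lborel. \<bar>f x\<bar> powr p) powr (1 / p)"

text \<open>
  A kernel is a function on the space without the origin; it is represented by a total function
  whose value at \<open>0\<close> is unconstrained and never matters.
\<close>

definition jump_kernel :: "('a::euclidean_space \<Rightarrow> real) \<Rightarrow> bool" where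
  "jump_kernel J \<longleftrightarrow>
     J \<in> borel_measurable lebesgue \<and>
     (\<forall>z. z \<noteq> 0 \<longrightarrow> 0 \<le> J z) \<and>
     (\<forall>y z. y \<noteq> 0 \<and> z \<noteq> 0 \<and> norm y = norm z \<longrightarrow> J y = J z) \<and>
     (\<exists>r>0. \<forall>z. 0 < norm z \<and> norm z < r \<longrightarrow> 0 < J z) \<and>
     integrable lebesgue (\<lambda>z. J z * min ((norm z)\<^sup>2) 1)"

definition multiplier :: "('a::euclidean_space \<Rightarrow> real) \<Rightarrow> 'a \<Rightarrow> real" where
  "multiplier J \<xi> = (LINT z|lebesgue. (1 - cos (z \<bullet> \<xi>)) * J z)"

definition fourier_measure :: "'a::euclidean_space measure \<Rightarrow> 'a \<Rightarrow> complex" where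
  "fourier_measure \<mu> \<xi> = (LINT x|\<mu>. cis (- (x \<bullet> \<xi>)))"

definition is_heat_measure :: "('a::euclidean_space \<Rightarrow> real) \<Rightarrow> real \<Rightarrow> 'a measure \<Rightarrow> bool" where
  "is_heat_measure J t \<mu> \<longleftrightarrow>
     prob_space \<mu> \<and> sets \<mu> = sets borel \<and>
     (\<forall>\<xi>. fourier_measure \<mu> \<xi> = complex_of_real (exp (- multiplier J \<xi> * t)))"

definition conv_measure ::
  "('a::euclidean_space \<Rightarrow> real) \<Rightarrow> 'a measure \<Rightarrow> 'a \<Rightarrow> real" where
  "conv_measure f \<mu> x = (LINT y|\<mu>. f (x - y))"

text \<open>
  The solution of \<open>\<partial>\<^sub>t u + \<L> u = 0\<close>, \<open>u(0) = u\<^sub>0\<close>, for \<open>u\<^sub>0 \<in> L\<^sup>1 \<inter> L\<^sup>2\<close>, is \<open>u(t) = u\<^sub>0 * \<mu>\<^sub>t\<close>,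
  with \<open>\<mu>\<^sub>t\<close> the probability measure whose Fourier transform is \<open>exp (- m t)\<close>.  As an element of
  \<open>L\<^sup>p\<close> it is determined only almost everywhere, so any Borel representative is allowed.
\<close>

definition is_solution ::
  "('a::euclidean_space \<Rightarrow> real) \<Rightarrow> ('a \<Rightarrow> real) \<Rightarrow> (real \<Rightarrow> 'a \<Rightarrow> real) \<Rightarrow> bool" where
  "is_solution J u0 u \<longleftrightarrow>
     (\<forall>t>0. u t \<in> borel_measurable lborel \<and>
        (\<exists>\<mu>. is_heat_measure J t \<mu> \<and> (AE x in lborel. u t x = conv_measure u0 \<mu> x)))"

end

theory Submission
  imports Defs
begin

text \<open>
  Idea. The measure \<open>\<mu>\<^sub>t\<close> is a limit of \<open>n\<close>-step random walks whose jump density is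
  \<open>t / n\<close> times a truncation of \<open>J\<close>.  The lower bound on \<open>J\<close> lets one split off from the jump
  density uniform densities on the dyadic annuli \<open>r\<^sub>i \<le> |z| < 2 r\<^sub>i\<close>,
  \<open>r\<^sub>i = t\<^bsup>1/\<alpha>\<^esup> 2\<^bsup>-i\<^esup> \<ge> R\<close>.  As soon as a walk makes one such jump its law has density at most
  \<open>c r\<^sub>i\<^bsup>-N\<^esup>\<close>, and the probability that it makes none on the annuli
  \<open>0, \<dots>, i - 1\<close> is at most \<open>exp (- c 2\<^bsup>(i-1)\<alpha>\<^esup>)\<close>.  Summing over \<open>i\<close> gives
  \<open>\<mu>\<^sub>t E \<le> C t\<^bsup>-N/\<alpha>\<^esup> |E| + exp (- c t)\<close> for every Borel set \<open>E\<close>; the Fourier transform enters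
  only in the passage to the limit \<open>n \<rightarrow> \<infinity>\<close>, tested against Gaussians.  So \<open>\<mu>\<^sub>t\<close> is the sum of
  a part with density \<open>O(t\<^bsup>-N/\<alpha>\<^esup>)\<close>, which maps \<open>L\<^sup>q\<close> to \<open>L\<^sup>p\<close> by Young's inequality, and a part of
  exponentially small mass, whose contribution is eventually negligible against \<open>\<parallel>u\<^sub>0\<parallel>\<^sub>q\<close>.
\<close>

section \<open>Random walks with a bounded-density jump component\<close>

text \<open>The obstacle is that \<open>J\<close> may be integrable near the origin. Then
  \<open>\<mu>\<^sub>t\<close> has an atom at 0 and maps no L^q into a better space, so a remainder
  of positive mass is unavoidable; it can only be measured against the L^p norm of the initial
  datum, which is why t0 depends on it. The remainder has size exp (- c t) because the lower bound
  on \<open>J\<close> stops at radius \<open>R\<close>: the smallest annulus has radius comparable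
  to \<open>R\<close>, and jumps into it occur at a rate bounded below, over a time t. The largest
  radius t^(1/\<alpha>) is the scale at which the expected number of the split-off jumps up to time
  t is of order one. At radius r_i that number is of order 2^(i \<alpha>), so the density bound,
  which worsens by a factor 2^(i N), is multiplied by a doubly exponentially small probability and
  the sum over i converges. Every estimate on walks is uniform in the number of steps. This permits
  a limit taken only for Gaussian averages, without constructing a jump process or a
  semigroup.\<close>

lemma nn_integral_lborel_shift:
  fixes f :: "'a::euclidean_space \<Rightarrow> ennreal"
  assumes [measurable]: "f \<in> borel_measurable borel"
  shows "(\<integral>\<^sup>+x. f (x + z) \<partial>lborel) = (\<integral>\<^sup>+x. f x \<partial>lborel)"
proof -
  have "(\<integral>\<^sup>+x. f x \<partial>lborel) = (\<integral>\<^sup>+x. f x \<partial>distr lborel borel ((+) z))"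
    by (simp add: lborel_distr_plus)
  also have "\<dots> = (\<integral>\<^sup>+x. f (x + z) \<partial>lborel)"
    by (subst nn_integral_distr) (auto simp: add.commute)
  finally show ?thesis by simp
qed

text \<open>The law of a step that stays put with weight \<open>w\<close> and jumps with density
  \<open>G\<close> is encoded by its action on functions, so that the n-step law is simply
  \<open>walk w G ^^ n\<close>. Values in \<open>ennreal\<close> give Tonelli without integrability
  conditions.\<close>

definition walk ::
  "ennreal \<Rightarrow> ('a::euclidean_space \<Rightarrow> ennreal) \<Rightarrow> ('a \<Rightarrow> ennreal) \<Rightarrow> 'a \<Rightarrow> ennreal" where
  "walk w G f x = w * f x + (\<integral>\<^sup>+z. G z * f (x + z) \<partial>lborel)"

lemma measurable_walk [measurable]:
  fixes G :: "'a::euclidean_space \<Rightarrow> ennreal"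
  assumes [measurable]: "G \<in> borel_measurable borel" "f \<in> borel_measurable borel"
  shows "walk w G f \<in> borel_measurable borel"
  unfolding walk_def by measurable

lemma measurable_walk_funpow [measurable]:
  fixes G :: "'a::euclidean_space \<Rightarrow> ennreal"
  assumes [measurable]: "G \<in> borel_measurable borel" "f \<in> borel_measurable borel"
  shows "(walk w G ^^ n) f \<in> borel_measurable borel"
  by (induction n) auto

lemma walk_mono: "(\<And>x. f x \<le> g x) \<Longrightarrow> walk w G f x \<le> walk w G g x"
  unfolding walk_def by (intro add_mono mult_left_mono nn_integral_mono) auto

lemma nn_integral_walk:
  fixes G :: "'a::euclidean_space \<Rightarrow> ennreal"
  assumes [measurable]: "G \<in> borel_measurable borel" "f \<in> borel_measurable borel"
  shows "(\<integral>\<^sup>+x. walk w G f x \<partial>lborel) = (w + (\<integral>\<^sup>+z. G z \<partial>lborel)) * (\<integral>\<^sup>+x. f x \<partial>lborel)"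
proof -
  have "(\<integral>\<^sup>+x. \<integral>\<^sup>+z. G z * f (x + z) \<partial>lborel \<partial>lborel)
      = (\<integral>\<^sup>+z. \<integral>\<^sup>+x. G z * f (x + z) \<partial>lborel \<partial>lborel)"
    by (rule lborel_pair.Fubini') measurable
  also have "\<dots> = (\<integral>\<^sup>+z. G z * (\<integral>\<^sup>+x. f x \<partial>lborel) \<partial>lborel)"
    by (intro nn_integral_cong) (simp add: nn_integral_cmult nn_integral_lborel_shift)
  finally show ?thesis
    unfolding walk_def
    by (simp add: nn_integral_add nn_integral_cmult nn_integral_multc algebra_simps)
qed

lemma nn_integral_walk_funpow:
  fixes G :: "'a::euclidean_space \<Rightarrow> ennreal"
  assumes [measurable]: "G \<in> borel_measurable borel" "f \<in> borel_measurable borel"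
  shows "(\<integral>\<^sup>+x. (walk w G ^^ n) f x \<partial>lborel)
    = (w + (\<integral>\<^sup>+z. G z \<partial>lborel)) ^ n * (\<integral>\<^sup>+x. f x \<partial>lborel)"
  by (induction n) (simp_all add: nn_integral_walk mult_ac)

text \<open>A jump drawn from \<open>H\<close> smooths the law to density at most \<open>D\<close>; \<open>G\<close> is what remains when no such jump occurs.\<close>

lemma walk_funpow_split:
  fixes G H :: "'a::euclidean_space \<Rightarrow> ennreal"
  assumes [measurable]: "G \<in> borel_measurable borel" "H \<in> borel_measurable borel"
      "f \<in> borel_measurable borel"
    and H_le: "\<And>z. H z \<le> D * (\<integral>\<^sup>+z. H z \<partial>lborel)"
  shows "(walk w (\<lambda>z. G z + H z) ^^ n) f x
    \<le> (walk w G ^^ n) f x + D * (w + (\<integral>\<^sup>+z. G z + H z \<partial>lborel)) ^ n * (\<integral>\<^sup>+x. f x \<partial>lborel)"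
proof (induction n arbitrary: x)
  case 0
  show ?case by simp
next
  case (Suc n)
  define F where "F = (walk w (\<lambda>z. G z + H z) ^^ n) f"
  define s where "s = w + (\<integral>\<^sup>+z. G z + H z \<partial>lborel)"
  define a where "a = (\<integral>\<^sup>+z. H z \<partial>lborel)"
  define I where "I = (\<integral>\<^sup>+x. f x \<partial>lborel)"
  have [measurable]: "F \<in> borel_measurable borel"
    unfolding F_def by measurable
  have s: "s = w + (\<integral>\<^sup>+z. G z \<partial>lborel) + a"
    by (simp add: s_def a_def nn_integral_add add.assoc)
  have "walk w (\<lambda>z. G z + H z) F x = walk w G F x + (\<integral>\<^sup>+z. H z * F (x + z) \<partial>lborel)"
    by (simp add: walk_def distrib_right nn_integral_add add.assoc)
  also have "walk w G F x \<le> walk w G (\<lambda>x. (walk w G ^^ n) f x + D * s ^ n * I) x"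
    using Suc by (intro walk_mono) (auto simp: F_def s_def I_def)
  also have "\<dots> = walk w G ((walk w G ^^ n) f) x + (w + (\<integral>\<^sup>+z. G z \<partial>lborel)) * (D * s ^ n * I)"
    by (simp add: walk_def distrib_left distrib_right nn_integral_add nn_integral_multc add_ac)
  \<comment> \<open>The pointwise bound on \<open>H\<close> pulls out \<open>D * a\<close>. What
    remains is the full integral of \<open>F\<close> by translation invariance, so the bound no
    longer depends on \<open>x\<close>.\<close>
  also have "(\<integral>\<^sup>+z. H z * F (x + z) \<partial>lborel) \<le> (\<integral>\<^sup>+z. (D * a) * F (x + z) \<partial>lborel)"
    using H_le by (intro nn_integral_mono mult_right_mono) (auto simp: a_def)
  also have "\<dots> = D * a * (s ^ n * I)"
    by (simp add: nn_integral_cmult nn_integral_lborel_shift add.commute[of x] F_def nn_integral_walk_funpow s_def I_def)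
  finally have "walk w (\<lambda>z. G z + H z) F x \<le>
     walk w G ((walk w G ^^ n) f) x + ((w + (\<integral>\<^sup>+z. G z \<partial>lborel)) * (D * s ^ n * I) + D * a * (s ^ n * I))"
    by (simp add: add_mono add_ac)
  \<comment> \<open>The mass \<open>w + \<integral>G\<close> of a step without \<open>H\<close> and
    the mass \<open>a\<close> of \<open>H\<close> add up to \<open>s\<close>, which supplies the
    missing power of \<open>s\<close>.\<close>
  also have "(w + (\<integral>\<^sup>+z. G z \<partial>lborel)) * (D * s ^ n * I) + D * a * (s ^ n * I) = D * s ^ Suc n * I"
    unfolding power_Suc by (subst (3) s) (simp add: distrib_left distrib_right mult_ac)
  finally show ?case
    by (simp add: F_def s_def I_def)
qed

text \<open>The single split is applied to \<open>H 0\<close>, \<open>H 1\<close>, ... in turn. When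
  component i is peeled off, the earlier ones have already left the jump density, so its term
  carries the n-th power of the mass without them, that is, the probability of avoiding them. This
  factor is what later compensates the growth of \<open>D i\<close>.\<close>

lemma walk_funpow_split_sum:
  fixes B :: "'a::euclidean_space \<Rightarrow> ennreal" and H :: "nat \<Rightarrow> 'a \<Rightarrow> ennreal"
  assumes [measurable]: "B \<in> borel_measurable borel" "\<And>i. H i \<in> borel_measurable borel"
      "f \<in> borel_measurable borel"
    and H_le: "\<And>i z. i < K \<Longrightarrow> H i z \<le> D i * (\<integral>\<^sup>+z. H i z \<partial>lborel)"
  shows "(walk w (\<lambda>z. B z + (\<Sum>i<K. H i z)) ^^ n) f x
    \<le> (walk w B ^^ n) f x
      + (\<Sum>i<K. D i * (w + (\<integral>\<^sup>+z. B z + (\<Sum>j\<in>{i..<K}. H j z) \<partial>lborel)) ^ n) * (\<integral>\<^sup>+x. f x \<partial>lborel)"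
proof -
  define G where "G i z = B z + (\<Sum>j\<in>{i..<K}. H j z)" for i z
  have [measurable]: "G i \<in> borel_measurable borel" for i
    unfolding G_def by measurable
  define S where "S m = (\<Sum>i<m. D i * (w + (\<integral>\<^sup>+z. G i z \<partial>lborel)) ^ n) * (\<integral>\<^sup>+x. f x \<partial>lborel)" for m
  have "(walk w (G 0) ^^ n) f x \<le> (walk w (G m) ^^ n) f x + S m" if "m \<le> K" for m
    using that
  proof (induction m)
    case 0
    show ?case by simp
  next
    case (Suc m)
    have G: "G m = (\<lambda>z. G (Suc m) z + H m z)"
      using Suc.prems by (simp add: G_def sum.atLeast_Suc_lessThan[of m K] add_ac fun_eq_iff)
    have "(walk w (G m) ^^ n) f x \<le> (walk w (G (Suc m)) ^^ n) f x
        + D m * (w + (\<integral>\<^sup>+z. G m z \<partial>lborel)) ^ n * (\<integral>\<^sup>+x. f x \<partial>lborel)"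
      unfolding G using Suc.prems by (intro walk_funpow_split H_le) auto
    then have "(walk w (G m) ^^ n) f x + S m \<le> (walk w (G (Suc m)) ^^ n) f x + S (Suc m)"
      by (simp add: S_def distrib_right add.assoc add.commute add_right_mono)
    with Suc show ?case
      by (meson Suc_leD order_trans)
  qed
  from this[of K] have "(walk w (G 0) ^^ n) f x \<le> (walk w (G K) ^^ n) f x + S K"
    by simp
  moreover have "G 0 = (\<lambda>z. B z + (\<Sum>i<K. H i z))" "G K = B"
    by (simp_all add: G_def fun_eq_iff atLeast0LessThan)
  ultimately show ?thesis
    by (simp add: S_def) (simp add: G_def)
qed

section \<open>Cosine transforms\<close>

lemma lborel_distr_uminus_euclidean:
  "distr lborel borel uminus = (lborel :: 'a::euclidean_space measure)"
  by (subst (2) lborel_affine[of "-1" 0]) (auto simp: density_1 one_ennreal_def[symmetric])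

lemma integral_lborel_reflect:
  fixes f :: "'a::euclidean_space \<Rightarrow> real"
  assumes [measurable]: "f \<in> borel_measurable borel"
  shows "(\<integral>z. f (- z) \<partial>lborel) = (\<integral>z. f z \<partial>lborel)"
  by (subst (2) lborel_distr_uminus_euclidean[symmetric]) (simp add: integral_distr)

text \<open>Evenness kills the sine term of the addition formula, so cosines are eigenfunctions of
  convolution with \<open>G\<close>. Hence real cosine transforms suffice for the walks.\<close>

lemma integral_cos_shift_even:
  fixes G :: "'a::euclidean_space \<Rightarrow> real"
  assumes G: "integrable lborel G" and even: "\<And>z. G (- z) = G z"
  shows "(\<integral>z. G z * cos ((x + z) \<bullet> \<xi>) \<partial>lborel) = (\<integral>z. G z * cos (z \<bullet> \<xi>) \<partial>lborel) * cos (x \<bullet> \<xi>)"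
proof -
  have [measurable]: "G \<in> borel_measurable borel"
    using borel_measurable_integrable[OF G] by simp
  have int: "integrable lborel (\<lambda>z. G z * cos (z \<bullet> \<xi>))" "integrable lborel (\<lambda>z. G z * sin (z \<bullet> \<xi>))"
    by (auto intro!: Bochner_Integration.integrable_bound[OF G] AE_I2 mult_left_le simp: abs_mult)
  have "(\<integral>z. G z * sin (z \<bullet> \<xi>) \<partial>lborel) = - (\<integral>z. G z * sin (z \<bullet> \<xi>) \<partial>lborel)"
    using integral_lborel_reflect[of "\<lambda>z. G z * sin (z \<bullet> \<xi>)"] by (simp add: even)
  then have sin0: "(\<integral>z. G z * sin (z \<bullet> \<xi>) \<partial>lborel) = 0"
    by simp
  have "(\<integral>z. G z * cos ((x + z) \<bullet> \<xi>) \<partial>lborel)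
      = (\<integral>z. cos (x \<bullet> \<xi>) * (G z * cos (z \<bullet> \<xi>)) - sin (x \<bullet> \<xi>) * (G z * sin (z \<bullet> \<xi>)) \<partial>lborel)"
    by (simp add: inner_add_left cos_add algebra_simps)
  also have "\<dots> = cos (x \<bullet> \<xi>) * (\<integral>z. G z * cos (z \<bullet> \<xi>) \<partial>lborel)"
    using int by (simp add: sin0)
  finally show ?thesis
    by simp
qed

text \<open>Each cosine is an eigenfunction of the step, so Fubini turns the step into
  multiplication of \<open>\<phi>\<close> by the symbol \<open>q\<close>. Nonnegativity is part of
  both hypotheses and conclusions because \<open>ennreal\<close> sends negative reals to 0: without
  it the real and the extended integral would not match.\<close>

lemma walk_cos_transform:
  fixes G :: "'a::euclidean_space \<Rightarrow> real" and \<gamma> :: "'a measure"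
  assumes G: "integrable lborel G" and G0: "\<And>z. 0 \<le> G z" and even: "\<And>z. G (- z) = G z"
    and "0 \<le> w" and \<gamma>: "finite_measure \<gamma>" "sets \<gamma> = sets borel"
    and [measurable]: "\<phi> \<in> borel_measurable borel" and bnd: "\<And>\<xi>. \<bar>\<phi> \<xi>\<bar> \<le> C"
    and nonneg: "\<And>x. 0 \<le> (\<integral>\<xi>. \<phi> \<xi> * cos (x \<bullet> \<xi>) \<partial>\<gamma>)"
  defines "q \<equiv> \<lambda>\<xi>. w + (\<integral>z. G z * cos (z \<bullet> \<xi>) \<partial>lborel)"
  shows "walk (ennreal w) (\<lambda>z. ennreal (G z)) (\<lambda>x. ennreal (\<integral>\<xi>. \<phi> \<xi> * cos (x \<bullet> \<xi>) \<partial>\<gamma>)) x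
      = ennreal (\<integral>\<xi>. (\<phi> \<xi> * q \<xi>) * cos (x \<bullet> \<xi>) \<partial>\<gamma>)" (is ?eq)
    and "0 \<le> (\<integral>\<xi>. (\<phi> \<xi> * q \<xi>) * cos (x \<bullet> \<xi>) \<partial>\<gamma>)" (is ?pos)
proof -
  interpret finite_measure \<gamma> by fact
  note [measurable_cong] = \<gamma>(2)
  have [measurable]: "G \<in> borel_measurable borel"
    using borel_measurable_integrable[OF G] by simp
  have C0: "0 \<le> C"
    using bnd[of 0] by (auto intro: order_trans[OF abs_ge_zero])
  define F where "F x = (\<integral>\<xi>. \<phi> \<xi> * cos (x \<bullet> \<xi>) \<partial>\<gamma>)" for x
  have [measurable]: "F \<in> borel_measurable borel"
    unfolding F_def by measurable
  have bnd': "\<bar>\<phi> \<xi> * cos t\<bar> \<le> C" for \<xi> t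
    unfolding abs_mult using bnd[of \<xi>] C0 abs_cos_le_one[of t]
    by (metis abs_ge_zero mult_mono' mult.right_neutral)
  have int_\<phi>: "integrable \<gamma> (\<lambda>\<xi>. \<phi> \<xi> * cos (x \<bullet> \<xi>))" for x
    using bnd' by (intro integrable_const_bound[of _ C]) auto
  have F_le: "\<bar>F x\<bar> \<le> C * measure \<gamma> (space \<gamma>)" for x
  proof -
    have "\<bar>F x\<bar> \<le> (\<integral>\<xi>. \<bar>\<phi> \<xi> * cos (x \<bullet> \<xi>)\<bar> \<partial>\<gamma>)"
      unfolding F_def using integral_norm_bound[of \<gamma> "\<lambda>\<xi>. \<phi> \<xi> * cos (x \<bullet> \<xi>)"] by simp
    also have "\<dots> \<le> (\<integral>\<xi>. C \<partial>\<gamma>)"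
      using bnd' int_\<phi> by (intro integral_mono integrable_abs) auto
    finally show ?thesis by (simp add: mult.commute)
  qed
  have intGF: "integrable lborel (\<lambda>z. G z * F (x + z))"
  proof (rule Bochner_Integration.integrable_bound)
    show "integrable lborel (\<lambda>z. G z * (C * measure \<gamma> (space \<gamma>)))"
      using G by simp
    show "AE z in lborel. norm (G z * F (x + z)) \<le> norm (G z * (C * measure \<gamma> (space \<gamma>)))"
      using F_le C0 by (auto simp: abs_mult G0 intro!: mult_left_mono)
  qed measurable
  interpret P: pair_sigma_finite lborel \<gamma> ..
  \<comment> \<open>Fubini is justified because \<open>G\<close> is integrable,
    \<open>\<phi>\<close> is bounded and \<open>\<gamma>\<close> is finite.\<close>
  have intP: "integrable (lborel \<Otimes>\<^sub>M \<gamma>) (\<lambda>(z, \<xi>). G z * (\<phi> \<xi> * cos ((x + z) \<bullet> \<xi>)))"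
  proof (rule P.Fubini_integrable)
    show "integrable lborel (\<lambda>z. \<integral>\<xi>. norm (case (z, \<xi>) of (z, \<xi>) \<Rightarrow> G z * (\<phi> \<xi> * cos ((x + z) \<bullet> \<xi>))) \<partial>\<gamma>)"
    proof (rule Bochner_Integration.integrable_bound)
      show "integrable lborel (\<lambda>z. G z * (C * measure \<gamma> (space \<gamma>)))"
        using G by simp
      have "(\<integral>\<xi>. \<bar>\<phi> \<xi> * cos ((x + z) \<bullet> \<xi>)\<bar> \<partial>\<gamma>) \<le> C * measure \<gamma> (space \<gamma>)" for z
      proof -
        have "(\<integral>\<xi>. \<bar>\<phi> \<xi> * cos ((x + z) \<bullet> \<xi>)\<bar> \<partial>\<gamma>) \<le> (\<integral>\<xi>. C \<partial>\<gamma>)"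
          using bnd' int_\<phi> by (intro integral_mono integrable_abs) auto
        then show ?thesis by (simp add: mult.commute)
      qed
      then show "AE z in lborel. norm (\<integral>\<xi>. norm (case (z, \<xi>) of (z, \<xi>) \<Rightarrow> G z * (\<phi> \<xi> * cos ((x + z) \<bullet> \<xi>))) \<partial>\<gamma>)
          \<le> norm (G z * (C * measure \<gamma> (space \<gamma>)))"
        using C0 by (auto simp: abs_mult G0 intro!: mult_left_mono)
    qed measurable
  qed (use int_\<phi> in auto)
  have "(\<integral>z. G z * F (x + z) \<partial>lborel) = (\<integral>z. (\<integral>\<xi>. G z * (\<phi> \<xi> * cos ((x + z) \<bullet> \<xi>)) \<partial>\<gamma>) \<partial>lborel)"
    unfolding F_def by simp
  also have "\<dots> = (\<integral>\<xi>. (\<integral>z. G z * (\<phi> \<xi> * cos ((x + z) \<bullet> \<xi>)) \<partial>lborel) \<partial>\<gamma>)"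
    using P.Fubini_integral[OF intP] by simp
  also have "\<dots> = (\<integral>\<xi>. \<phi> \<xi> * (\<integral>z. G z * cos (z \<bullet> \<xi>) \<partial>lborel) * cos (x \<bullet> \<xi>) \<partial>\<gamma>)"
  proof (rule Bochner_Integration.integral_cong[OF refl])
    fix \<xi>
    have "(\<integral>z. G z * (\<phi> \<xi> * cos ((x + z) \<bullet> \<xi>)) \<partial>lborel) = \<phi> \<xi> * (\<integral>z. G z * cos ((x + z) \<bullet> \<xi>) \<partial>lborel)"
      by (subst integral_mult_right_zero[symmetric]) (simp add: mult_ac)
    also have "\<dots> = \<phi> \<xi> * (\<integral>z. G z * cos (z \<bullet> \<xi>) \<partial>lborel) * cos (x \<bullet> \<xi>)"
      using integral_cos_shift_even[OF G even] by simp
    finally show "(\<integral>z. G z * (\<phi> \<xi> * cos ((x + z) \<bullet> \<xi>)) \<partial>lborel) = \<dots>" .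
  qed
  finally have conv: "(\<integral>z. G z * F (x + z) \<partial>lborel) = \<dots>" .
  define b where "b = (\<integral>z. G z \<partial>lborel)"
  have qb: "\<bar>\<integral>z. G z * cos (z \<bullet> \<xi>) \<partial>lborel\<bar> \<le> b" for \<xi>
  proof -
    have "norm (\<integral>z. G z * cos (z \<bullet> \<xi>) \<partial>lborel) \<le> (\<integral>z. norm (G z * cos (z \<bullet> \<xi>)) \<partial>lborel)"
      by (rule integral_norm_bound)
    also have "\<dots> \<le> b"
      unfolding b_def
      by (intro integral_mono Bochner_Integration.integrable_bound[OF G])
        (auto simp: abs_mult G0 intro!: mult_left_le)
    finally show ?thesis by simp
  qed
  have int2: "integrable \<gamma> (\<lambda>\<xi>. \<phi> \<xi> * (\<integral>z. G z * cos (z \<bullet> \<xi>) \<partial>lborel) * cos (x \<bullet> \<xi>))"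
  proof (intro integrable_const_bound[of _ "C * b"] AE_I2)
    fix \<xi>
    have "norm (\<phi> \<xi> * (\<integral>z. G z * cos (z \<bullet> \<xi>) \<partial>lborel) * cos (x \<bullet> \<xi>))
      = \<bar>\<phi> \<xi> * cos (x \<bullet> \<xi>)\<bar> * \<bar>\<integral>z. G z * cos (z \<bullet> \<xi>) \<partial>lborel\<bar>"
      by (simp add: abs_mult)
    also have "\<dots> \<le> C * b"
      using bnd' qb C0 by (intro mult_mono) auto
    finally show "norm (\<phi> \<xi> * (\<integral>z. G z * cos (z \<bullet> \<xi>) \<partial>lborel) * cos (x \<bullet> \<xi>)) \<le> C * b" .
  qed measurable
  have tot: "(\<integral>\<xi>. (\<phi> \<xi> * q \<xi>) * cos (x \<bullet> \<xi>) \<partial>\<gamma>) = w * F x + (\<integral>z. G z * F (x + z) \<partial>lborel)"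
    unfolding conv unfolding F_def q_def
    using int2 int_\<phi>
    by (subst integral_mult_right_zero[symmetric], subst Bochner_Integration.integral_add[symmetric])
      (auto simp: algebra_simps)
  have F0: "0 \<le> F x" for x
    using nonneg by (simp add: F_def)
  show ?pos
    unfolding tot using \<open>0 \<le> w\<close> F0 G0 by (intro add_nonneg_nonneg mult_nonneg_nonneg integral_nonneg_AE) auto
  have "(\<integral>\<^sup>+z. ennreal (G z) * ennreal (F (x + z)) \<partial>lborel) = ennreal (\<integral>z. G z * F (x + z) \<partial>lborel)"
    using intGF F0 G0 by (subst nn_integral_eq_integral[symmetric]) (auto simp: ennreal_mult)
  then show ?eq
    unfolding tot walk_def F_def[symmetric]
    using \<open>0 \<le> w\<close> F0 G0 by (simp add: ennreal_plus ennreal_mult integral_nonneg_AE)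
qed

lemma walk_funpow_cos_transform:
  fixes G :: "'a::euclidean_space \<Rightarrow> real" and \<gamma> :: "'a measure"
  assumes G: "integrable lborel G" "\<And>z. 0 \<le> G z" "\<And>z. G (- z) = G z"
    and "0 \<le> w" and \<gamma>: "finite_measure \<gamma>" "sets \<gamma> = sets borel"
    and nonneg: "\<And>x. 0 \<le> (\<integral>\<xi>. cos (x \<bullet> \<xi>) \<partial>\<gamma>)"
  defines "q \<equiv> \<lambda>\<xi>. w + (\<integral>z. G z * cos (z \<bullet> \<xi>) \<partial>lborel)"
  shows "(walk (ennreal w) (\<lambda>z. ennreal (G z)) ^^ n) (\<lambda>x. ennreal (\<integral>\<xi>. cos (x \<bullet> \<xi>) \<partial>\<gamma>))
      = (\<lambda>x. ennreal (\<integral>\<xi>. q \<xi> ^ n * cos (x \<bullet> \<xi>) \<partial>\<gamma>))"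
proof -
  have [measurable]: "G \<in> borel_measurable borel"
    using borel_measurable_integrable[OF G(1)] by simp
  have [measurable]: "q \<in> borel_measurable borel"
    unfolding q_def by measurable
  define b where "b = w + (\<integral>z. G z \<partial>lborel)"
  have q_le: "\<bar>q \<xi>\<bar> \<le> b" for \<xi>
  proof -
    have "norm (\<integral>z. G z * cos (z \<bullet> \<xi>) \<partial>lborel) \<le> (\<integral>z. norm (G z * cos (z \<bullet> \<xi>)) \<partial>lborel)"
      by (rule integral_norm_bound)
    also have "\<dots> \<le> (\<integral>z. G z \<partial>lborel)"
      by (intro integral_mono Bochner_Integration.integrable_bound[OF G(1)])
        (auto simp: abs_mult G(2) intro!: mult_left_le)
    finally show ?thesis
      using \<open>0 \<le> w\<close> by (simp add: q_def b_def)
  qed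
  \<comment> \<open>Nonnegativity is carried through the induction together with the formula, since
    the next step requires it.\<close>
  have "(walk (ennreal w) (\<lambda>z. ennreal (G z)) ^^ n) (\<lambda>x. ennreal (\<integral>\<xi>. cos (x \<bullet> \<xi>) \<partial>\<gamma>))
      = (\<lambda>x. ennreal (\<integral>\<xi>. q \<xi> ^ n * cos (x \<bullet> \<xi>) \<partial>\<gamma>)) \<and> (\<forall>x. 0 \<le> (\<integral>\<xi>. q \<xi> ^ n * cos (x \<bullet> \<xi>) \<partial>\<gamma>))"
  proof (induction n)
    case 0
    show ?case using nonneg by simp
  next
    case (Suc n)
    have "\<bar>q \<xi> ^ n\<bar> \<le> b ^ n" for \<xi>
      using q_le by (simp add: power_abs power_mono)
    note step = walk_cos_transform[OF G \<open>0 \<le> w\<close> \<gamma>, of "\<lambda>\<xi>. q \<xi> ^ n" "b ^ n", OF _ this]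
    have "q \<xi> ^ Suc n = q \<xi> ^ n * (w + (\<integral>z. G z * cos (z \<bullet> \<xi>) \<partial>lborel))" for \<xi>
      by (simp add: q_def)
    with Suc.IH step show ?case
      by (simp del: power_Suc)
  qed
  then show ?thesis ..
qed

section \<open>Convergence of the walk symbols and Gaussian test functions\<close>

lemma power_exp_limit:
  fixes x :: "nat \<Rightarrow> real"
  assumes x: "x \<longlonglongrightarrow> l" and le1: "\<And>n. \<bar>1 - x n / real n\<bar> \<le> 1" and "0 \<le> l"
  shows "(\<lambda>n. (1 - x n / real n) ^ n) \<longlonglongrightarrow> exp (- l)"
proof -
  have "(\<lambda>n. (1 + (- l) / real n) ^ n) \<longlonglongrightarrow> exp (- l)"
    by (rule tendsto_exp_limit_sequentially)
  moreover have "(\<lambda>n. (1 - x n / real n) ^ n - (1 + (- l) / real n) ^ n) \<longlonglongrightarrow> 0"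
  proof (rule Lim_null_comparison)
    have "\<forall>\<^sub>F n in sequentially. l \<le> real n \<and> 0 < n"
      by (intro eventually_conj eventually_gt_at_top) real_asymp
    then show "\<forall>\<^sub>F n in sequentially. norm ((1 - x n / real n) ^ n - (1 + (- l) / real n) ^ n) \<le> \<bar>x n - l\<bar>"
    proof eventually_elim
      case (elim n)
      \<comment> \<open>For bases in [-1, 1] the n-th powers differ by at most n times the
        difference of the bases, which here is exactly \<open>\<bar>x n - l\<bar>\<close>. The
        condition \<open>l \<le> real n\<close> puts the second base into that range.\<close>
      have "norm ((1 - x n / real n) ^ n - (1 + (- l) / real n) ^ n)
          \<le> n * norm ((1 - x n / real n) - (1 + (- l) / real n))"
        using elim \<open>0 \<le> l\<close> le1[of n] by (intro norm_power_diff) (auto simp: abs_if field_simps)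
      also have "(1 - x n / real n) - (1 + (- l) / real n) = (l - x n) / real n"
        by (simp add: diff_divide_distrib)
      finally show ?case
        using elim by (simp add: abs_minus_commute)
    qed
    show "(\<lambda>n. \<bar>x n - l\<bar>) \<longlonglongrightarrow> 0"
      using x by (simp add: LIM_zero tendsto_rabs_zero)
  qed
  ultimately show ?thesis
    by (rule Lim_transform)
qed

text \<open>The half-angle formula and Cauchy-Schwarz give the term in \<open>norm \<xi>\<close> for
  small \<open>z\<close>; the summand 2 covers large \<open>z\<close>, where only
  \<open>cos \<ge> -1\<close> is available.\<close>

lemma one_minus_cos_le:
  fixes z \<xi> :: "'a::euclidean_space"
  shows "1 - cos (z \<bullet> \<xi>) \<le> (2 + (norm \<xi>)\<^sup>2) * min ((norm z)\<^sup>2) 1"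
proof (cases "norm z \<le> 1")
  case True
  define s where "s = (z \<bullet> \<xi>) / 2"
  have "1 - cos (z \<bullet> \<xi>) = 2 * (sin s)\<^sup>2"
    using cos_double_sin[of s] by (simp add: s_def)
  also have "(sin s)\<^sup>2 \<le> s\<^sup>2"
    using abs_sin_x_le_abs_x[of s] by (simp only: abs_le_square_iff)
  also have "2 * s\<^sup>2 \<le> (2 * s)\<^sup>2"
    by (simp add: power_mult_distrib)
  also have "\<dots> \<le> (norm z * norm \<xi>)\<^sup>2"
    using Cauchy_Schwarz_ineq2[of z \<xi>] by (simp add: abs_le_square_iff[symmetric] s_def abs_mult)
  also have "\<dots> \<le> (2 + (norm \<xi>)\<^sup>2) * (norm z)\<^sup>2"
    by (simp add: power_mult_distrib algebra_simps)
  finally show ?thesis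
    using True by (simp add: power_le_one min_def)
next
  case False
  then have "1 \<le> (norm z)\<^sup>2"
    by (simp add: one_le_power)
  then show ?thesis
    using cos_ge_minus_one[of "z \<bullet> \<xi>"] by (simp add: min_def add_increasing2)
qed

lemma integrable_multiplier:
  fixes J :: "'a::euclidean_space \<Rightarrow> real"
  assumes [measurable]: "J \<in> borel_measurable borel"
    and J0: "\<And>z. 0 \<le> J z"
    and J1: "integrable lborel (\<lambda>z. J z * min ((norm z)\<^sup>2) 1)"
  shows "integrable lborel (\<lambda>z. (1 - cos (z \<bullet> \<xi>)) * J z)"
proof (rule Bochner_Integration.integrable_bound)
  show "integrable lborel (\<lambda>z. (2 + (norm \<xi>)\<^sup>2) * (J z * min ((norm z)\<^sup>2) 1))"
    using J1 by simp
  have "norm ((1 - cos (z \<bullet> \<xi>)) * J z) \<le> norm ((2 + (norm \<xi>)\<^sup>2) * (J z * min ((norm z)\<^sup>2) 1))" for z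
    using mult_right_mono[OF one_minus_cos_le[of z \<xi>] J0[of z]] J0[of z]
    by (simp add: abs_mult mult_ac)
  then show "AE z in lborel. norm ((1 - cos (z \<bullet> \<xi>)) * J z) \<le> norm ((2 + (norm \<xi>)\<^sup>2) * (J z * min ((norm z)\<^sup>2) 1))"
    by simp
qed measurable

text \<open>
  The inner minimum caps \<open>t / n * J\<close> so that the jump density is integrable with mass at most \<open>1\<close>
  for every \<open>n\<close>; at a fixed \<open>z \<noteq> 0\<close> the cap is inactive for large \<open>n\<close>.
\<close>

definition small_step :: "('a::euclidean_space \<Rightarrow> real) \<Rightarrow> real \<Rightarrow> nat \<Rightarrow> 'a \<Rightarrow> real" where
  "small_step J t n z =
     J z * min (t / real n) (min ((norm z)\<^sup>2) 1 / ((LINT y|lborel. J y * min ((norm y)\<^sup>2) 1) + 1))"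

context
  fixes J :: "'a::euclidean_space \<Rightarrow> real" and t :: real
  assumes J_meas [measurable]: "J \<in> borel_measurable borel"
    and J_nonneg: "\<And>z. 0 \<le> J z"
    and J_even: "\<And>z. J (- z) = J z"
    and J_int: "integrable lborel (\<lambda>z. J z * min ((norm z)\<^sup>2) 1)"
    and t_pos: "0 < t"
begin

lemma J_mass_nonneg: "0 \<le> (LINT y|lborel. J y * min ((norm y)\<^sup>2) 1)"
  using J_nonneg by (intro integral_nonneg_AE) auto

lemma small_step_nonneg: "0 \<le> small_step J t n z"
  using J_nonneg t_pos J_mass_nonneg by (simp add: small_step_def)

lemma small_step_even: "small_step J t n (- z) = small_step J t n z"
  using J_even by (simp add: small_step_def)

lemma measurable_small_step [measurable]: "small_step J t n \<in> borel_measurable borel"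
  unfolding small_step_def by measurable

lemma integrable_small_step: "integrable lborel (small_step J t n)"
proof (rule Bochner_Integration.integrable_bound)
  let ?C = "(LINT y|lborel. J y * min ((norm y)\<^sup>2) 1) + 1"
  show "integrable lborel (\<lambda>z. J z * min ((norm z)\<^sup>2) 1 / ?C)"
    using J_int by simp
  have "small_step J t n z \<le> J z * min ((norm z)\<^sup>2) 1 / ?C" for z
    unfolding small_step_def times_divide_eq_right[symmetric]
    using J_nonneg by (intro mult_left_mono) auto
  then show "AE z in lborel. norm (small_step J t n z) \<le> norm (J z * min ((norm z)\<^sup>2) 1 / ?C)"
    using J_nonneg J_mass_nonneg small_step_nonneg by (intro AE_I2) (simp add: order_trans[OF _ abs_ge_self])
qed measurable

lemma small_step_mass: "(LINT z|lborel. small_step J t n z) \<le> 1"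
proof -
  let ?I = "LINT y|lborel. J y * min ((norm y)\<^sup>2) 1"
  have "(LINT z|lborel. small_step J t n z) \<le> (LINT z|lborel. J z * min ((norm z)\<^sup>2) 1 / (?I + 1))"
  proof (rule integral_mono)
    show "small_step J t n z \<le> J z * min ((norm z)\<^sup>2) 1 / (?I + 1)" for z
      unfolding small_step_def times_divide_eq_right[symmetric]
      using J_nonneg by (intro mult_left_mono) auto
  qed (use J_int integrable_small_step in auto)
  also have "\<dots> \<le> 1"
    using J_mass_nonneg by simp
  finally show ?thesis .
qed

lemma small_step_eq:
  assumes "t * ((LINT y|lborel. J y * min ((norm y)\<^sup>2) 1) + 1) \<le> real n * min ((norm z)\<^sup>2) 1"
  shows "small_step J t n z = t / real n * J z"
proof -
  define C where "C = (LINT y|lborel. J y * min ((norm y)\<^sup>2) 1) + 1"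
  define m where "m = min ((norm z)\<^sup>2) 1"
  have C: "0 < C" using J_mass_nonneg by (simp add: C_def)
  have "0 < t * C" using t_pos C by simp
  \<comment> \<open>The hypothesis itself excludes n = 0, because its left-hand side is
    positive.\<close>
  with assms have n: "0 < real n"
    by (cases "n = 0") (auto simp: C_def[symmetric])
  have "t * C \<le> real n * m"
    using assms by (simp add: C_def m_def)
  then have "t / real n \<le> m / C"
    using n C by (simp add: pos_divide_le_eq pos_le_divide_eq mult.commute)
  then show ?thesis
    unfolding small_step_def C_def[symmetric] m_def[symmetric] by (simp add: min_absorb1)
qed

text \<open>Removing the cap from \<open>real n * small_step J t n z\<close> leaves at most
  \<open>t * J z\<close>, so the integrand of the multiplier is a majorant for dominated
  convergence. Pointwise the sequence is eventually constant for z \<noteq> 0, and at z = 0, where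
  the cap never lifts, the factor 1 - cos vanishes.\<close>

lemma small_step_symbol:
  "(\<lambda>n. (LINT z|lborel. (1 - cos (z \<bullet> \<xi>)) * (real n * small_step J t n z)))
     \<longlonglongrightarrow> t * (LINT z|lborel. (1 - cos (z \<bullet> \<xi>)) * J z)"
proof -
  let ?C = "(LINT y|lborel. J y * min ((norm y)\<^sup>2) 1) + 1"
  have "(\<lambda>n. (LINT z|lborel. (1 - cos (z \<bullet> \<xi>)) * (real n * small_step J t n z)))
     \<longlonglongrightarrow> (LINT z|lborel. t * ((1 - cos (z \<bullet> \<xi>)) * J z))"
  proof (rule integral_dominated_convergence)
    show "integrable lborel (\<lambda>z. t * ((1 - cos (z \<bullet> \<xi>)) * J z))"
      by (intro integrable_mult_right integrable_multiplier J_nonneg J_int) measurable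
    show "AE z in lborel. norm ((1 - cos (z \<bullet> \<xi>)) * (real n * small_step J t n z))
        \<le> t * ((1 - cos (z \<bullet> \<xi>)) * J z)" for n
    proof (rule AE_I2)
      fix z
      have "real n * small_step J t n z \<le> real n * (J z * (t / real n))"
        unfolding small_step_def using J_nonneg by (intro mult_left_mono) auto
      also have "\<dots> \<le> t * J z"
        using J_nonneg t_pos by (cases "n = 0") auto
      finally have "(1 - cos (z \<bullet> \<xi>)) * (real n * small_step J t n z) \<le> (1 - cos (z \<bullet> \<xi>)) * (t * J z)"
        by (intro mult_left_mono) auto
      then show "norm ((1 - cos (z \<bullet> \<xi>)) * (real n * small_step J t n z))
        \<le> t * ((1 - cos (z \<bullet> \<xi>)) * J z)"
        using small_step_nonneg[of n z] by (simp add: abs_mult mult_ac)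
    qed
    show "AE z in lborel. (\<lambda>n. (1 - cos (z \<bullet> \<xi>)) * (real n * small_step J t n z))
        \<longlonglongrightarrow> t * ((1 - cos (z \<bullet> \<xi>)) * J z)"
    proof (rule AE_I2)
      fix z :: 'a
      show "(\<lambda>n. (1 - cos (z \<bullet> \<xi>)) * (real n * small_step J t n z)) \<longlonglongrightarrow> t * ((1 - cos (z \<bullet> \<xi>)) * J z)"
      proof (cases "z = 0")
        case False
        then have m: "0 < min ((norm z)\<^sup>2) 1"
          by simp
        obtain k :: nat where k: "t * ?C / min ((norm z)\<^sup>2) 1 \<le> real k"
          using real_arch_simple by blast
        have "\<forall>\<^sub>F n in sequentially. k \<le> n \<and> 0 < n"
          by (intro eventually_conj eventually_ge_at_top eventually_gt_at_top)
        then have "\<forall>\<^sub>F n in sequentially. (1 - cos (z \<bullet> \<xi>)) * (real n * small_step J t n z)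
            = t * ((1 - cos (z \<bullet> \<xi>)) * J z)"
        proof eventually_elim
          case (elim n)
          have "t * ?C \<le> real k * min ((norm z)\<^sup>2) 1"
            using k m by (simp only: pos_divide_le_eq)
          also have "\<dots> \<le> real n * min ((norm z)\<^sup>2) 1"
            using elim m by (intro mult_right_mono) auto
          finally have "small_step J t n z = t / real n * J z"
            by (rule small_step_eq)
          then show ?case
            using elim by simp
        qed
        then show ?thesis
          by (rule tendsto_eventually)
      qed simp
    qed
  qed measurable
  then show ?thesis
    by simp
qed

text \<open>If the test function is itself a cosine transform, n steps multiply its frequency
  density by \<open>q n \<xi> ^ n\<close>, where \<open>q n \<xi> = 1 - r n \<xi> / n\<close> and
  \<open>r n \<xi>\<close> tends to \<open>t * m \<xi>\<close>. All these symbols are bounded by 1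
  and \<open>\<gamma>\<close> is a probability measure, so pointwise convergence is enough and no
  continuity theorem for characteristic functions is involved.\<close>

lemma walk_small_step_limit:
  fixes \<mu> \<gamma> :: "'a measure"
  assumes \<mu>: "prob_space \<mu>" "sets \<mu> = sets borel"
    and cos_\<mu>: "\<And>\<xi>. (LINT x|\<mu>. cos (x \<bullet> \<xi>)) = exp (- (LINT z|lborel. (1 - cos (z \<bullet> \<xi>)) * J z) * t)"
    and sin_\<mu>: "\<And>\<xi>. (LINT x|\<mu>. sin (x \<bullet> \<xi>)) = 0"
    and \<gamma>: "prob_space \<gamma>" "sets \<gamma> = sets borel"
    and nonneg: "\<And>x. 0 \<le> (LINT \<xi>|\<gamma>. cos (x \<bullet> \<xi>))"
  shows "(\<lambda>n. (walk (ennreal (1 - (LINT z|lborel. small_step J t n z))) (\<lambda>z. ennreal (small_step J t n z)) ^^ n)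
            (\<lambda>x. ennreal (LINT \<xi>|\<gamma>. cos (x \<bullet> \<xi>))) x)
    \<longlonglongrightarrow> ennreal (LINT y|\<mu>. LINT \<xi>|\<gamma>. cos ((x - y) \<bullet> \<xi>))"
proof -
  interpret M: prob_space \<mu> by fact
  interpret G: prob_space \<gamma> by fact
  note [measurable_cong] = \<mu>(2) \<gamma>(2)
  define m where "m \<xi> = (LINT z|lborel. (1 - cos (z \<bullet> \<xi>)) * J z)" for \<xi>
  define q where "q n \<xi> = (1 - (LINT z|lborel. small_step J t n z)) + (LINT z|lborel. small_step J t n z * cos (z \<bullet> \<xi>))"
    for n \<xi>
  define r where "r n \<xi> = (LINT z|lborel. (1 - cos (z \<bullet> \<xi>)) * (real n * small_step J t n z))" for n \<xi>
  have [measurable]: "q n \<in> borel_measurable borel" for n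
    unfolding q_def by measurable
  have int_cos: "integrable lborel (\<lambda>z. small_step J t n z * cos (z \<bullet> \<xi>))" for n \<xi>
    by (rule Bochner_Integration.integrable_bound[OF integrable_small_step[of n]])
      (auto simp: abs_mult intro!: AE_I2 mult_left_le)
  have q_le1: "\<bar>q n \<xi>\<bar> \<le> 1" for n \<xi>
  proof -
    have "norm (LINT z|lborel. small_step J t n z * cos (z \<bullet> \<xi>))
        \<le> (LINT z|lborel. norm (small_step J t n z * cos (z \<bullet> \<xi>)))"
      by (rule integral_norm_bound)
    also have "\<dots> \<le> (LINT z|lborel. small_step J t n z)"
      using small_step_nonneg[of n] int_cos[of n \<xi>]
      by (intro integral_mono integrable_small_step integrable_norm)
        (auto simp: abs_mult intro!: mult_left_le)
    finally show ?thesis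
      using small_step_mass[of n] by (simp add: q_def)
  qed
  have q_eq: "q n \<xi> = 1 - r n \<xi> / real n" if "0 < n" for n \<xi>
  proof -
    have "r n \<xi> = (LINT z|lborel. real n * (small_step J t n z - small_step J t n z * cos (z \<bullet> \<xi>)))"
      unfolding r_def by (rule Bochner_Integration.integral_cong) (simp_all add: left_diff_distrib right_diff_distrib mult_ac)
    also have "\<dots> = real n * (LINT z|lborel. small_step J t n z - small_step J t n z * cos (z \<bullet> \<xi>))"
      by (rule integral_mult_right_zero)
    also have "\<dots> = real n * ((LINT z|lborel. small_step J t n z) - (LINT z|lborel. small_step J t n z * cos (z \<bullet> \<xi>)))"
      by (subst Bochner_Integration.integral_diff[OF integrable_small_step int_cos]) simp
    finally show ?thesis
      using that by (simp add: q_def)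
  qed
  have m0: "0 \<le> m \<xi>" for \<xi>
    unfolding m_def using J_nonneg by (intro integral_nonneg_AE AE_I2 mult_nonneg_nonneg) auto
  have q_lim: "(\<lambda>n. q n \<xi> ^ n) \<longlonglongrightarrow> exp (- m \<xi> * t)" for \<xi>
  proof -
    \<comment> \<open>At n = 0 the quotient is 0 by the convention for division.\<close>
    have le1: "\<bar>1 - r n \<xi> / real n\<bar> \<le> 1" for n
    proof (cases "n = 0")
      case False
      then show ?thesis
        using q_le1[of n \<xi>] by (simp only: q_eq[symmetric] neq0_conv)
    qed simp
    have "(\<lambda>n. (1 - r n \<xi> / real n) ^ n) \<longlonglongrightarrow> exp (- (t * m \<xi>))"
    proof (rule power_exp_limit[OF _ le1])
      show "(\<lambda>n. r n \<xi>) \<longlonglongrightarrow> t * m \<xi>"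
        unfolding r_def m_def by (rule small_step_symbol)
      show "0 \<le> t * m \<xi>"
        using m0[of \<xi>] t_pos by simp
    qed
    moreover have "\<forall>\<^sub>F n in sequentially. (1 - r n \<xi> / real n) ^ n = q n \<xi> ^ n"
      using eventually_gt_at_top[of 0] by eventually_elim (simp add: q_eq)
    ultimately have "(\<lambda>n. q n \<xi> ^ n) \<longlonglongrightarrow> exp (- (t * m \<xi>))"
      by (rule Lim_transform_eventually)
    then show ?thesis
      by (simp add: mult.commute)
  qed
  have [measurable]: "m \<in> borel_measurable borel"
    unfolding m_def by measurable
  have "(\<lambda>n. LINT \<xi>|\<gamma>. q n \<xi> ^ n * cos (x \<bullet> \<xi>)) \<longlonglongrightarrow> (LINT \<xi>|\<gamma>. exp (- m \<xi> * t) * cos (x \<bullet> \<xi>))"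
  proof (rule integral_dominated_convergence)
    show "AE \<xi> in \<gamma>. norm (q n \<xi> ^ n * cos (x \<bullet> \<xi>)) \<le> 1" for n
    proof (rule AE_I2)
      fix \<xi>
      have "\<bar>q n \<xi> ^ n\<bar> \<le> 1"
        using q_le1 by (simp add: power_abs power_le_one)
      then show "norm (q n \<xi> ^ n * cos (x \<bullet> \<xi>)) \<le> 1"
        using abs_cos_le_one[of "x \<bullet> \<xi>"] by (simp add: abs_mult mult_le_one)
    qed
    show "AE \<xi> in \<gamma>. (\<lambda>n. q n \<xi> ^ n * cos (x \<bullet> \<xi>)) \<longlonglongrightarrow> exp (- m \<xi> * t) * cos (x \<bullet> \<xi>)"
      using q_lim by (intro AE_I2 tendsto_intros)
  qed auto
  moreover have "(LINT \<xi>|\<gamma>. exp (- m \<xi> * t) * cos (x \<bullet> \<xi>)) = (LINT y|\<mu>. LINT \<xi>|\<gamma>. cos ((x - y) \<bullet> \<xi>))"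
  proof -
    interpret P: pair_prob_space \<mu> \<gamma> ..
    \<comment> \<open>By Fubini \<open>\<mu>\<close> acts on each frequency separately; its
      vanishing sine transform reduces the addition formula to a single product.\<close>
    have "(LINT y|\<mu>. LINT \<xi>|\<gamma>. cos ((x - y) \<bullet> \<xi>)) = (LINT \<xi>|\<gamma>. LINT y|\<mu>. cos ((x - y) \<bullet> \<xi>))"
      by (intro P.Fubini_integral[symmetric] P.P.integrable_const_bound[of _ 1]) auto
    also have "\<dots> = (LINT \<xi>|\<gamma>. exp (- m \<xi> * t) * cos (x \<bullet> \<xi>))"
    proof (rule Bochner_Integration.integral_cong[OF refl])
      fix \<xi>
      have int: "integrable \<mu> (\<lambda>y. cos (y \<bullet> \<xi>))" "integrable \<mu> (\<lambda>y. sin (y \<bullet> \<xi>))"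
        by (auto intro!: M.integrable_const_bound[of _ 1])
      have "(LINT y|\<mu>. cos ((x - y) \<bullet> \<xi>))
          = (LINT y|\<mu>. cos (x \<bullet> \<xi>) * cos (y \<bullet> \<xi>) + sin (x \<bullet> \<xi>) * sin (y \<bullet> \<xi>))"
        by (simp add: inner_diff_left cos_diff)
      also have "\<dots> = exp (- m \<xi> * t) * cos (x \<bullet> \<xi>)"
        using int by (simp add: cos_\<mu> sin_\<mu> m_def)
      finally show "(LINT y|\<mu>. cos ((x - y) \<bullet> \<xi>)) = exp (- m \<xi> * t) * cos (x \<bullet> \<xi>)" .
    qed
    finally show ?thesis ..
  qed
  ultimately have "(\<lambda>n. LINT \<xi>|\<gamma>. q n \<xi> ^ n * cos (x \<bullet> \<xi>)) \<longlonglongrightarrow> (LINT y|\<mu>. LINT \<xi>|\<gamma>. cos ((x - y) \<bullet> \<xi>))"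
    by simp
  moreover have "(walk (ennreal (1 - (LINT z|lborel. small_step J t n z))) (\<lambda>z. ennreal (small_step J t n z)) ^^ n)
            (\<lambda>x. ennreal (LINT \<xi>|\<gamma>. cos (x \<bullet> \<xi>))) = (\<lambda>x. ennreal (LINT \<xi>|\<gamma>. q n \<xi> ^ n * cos (x \<bullet> \<xi>)))" for n
    unfolding q_def
    by (intro walk_funpow_cos_transform integrable_small_step small_step_nonneg small_step_even
        nonneg \<gamma> G.finite_measure_axioms) (simp add: small_step_mass)
  ultimately show ?thesis
    by (simp add: tendsto_ennrealI)
qed

end

text \<open>The measure is the centred normal law with variance 1/\<sigma>^2 in each coordinate. It
  makes Gaussians admissible in the cosine-transform lemmas, which ask for a nonnegative transform
  of a finite measure.\<close>

lemma gaussian_cos_transform: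
  assumes "0 < \<sigma>"
  obtains \<gamma> :: "'a::euclidean_space measure" where "prob_space \<gamma>" "sets \<gamma> = sets borel"
    "\<And>x. (LINT \<xi>|\<gamma>. cos (x \<bullet> \<xi>)) = exp (- ((norm x)\<^sup>2 / (2 * \<sigma>\<^sup>2)))"
proof
  interpret S: prob_space std_normal_distribution
    by (rule prob_space_normal_density) simp
  interpret N: product_prob_space "\<lambda>_::'a. std_normal_distribution" Basis ..
  let ?P = "\<Pi>\<^sub>M b\<in>(Basis::'a set). std_normal_distribution"
  let ?\<gamma> = "distr ?P borel (\<lambda>f. \<Sum>b\<in>Basis. (f b / \<sigma>) *\<^sub>R b) :: 'a measure"
  show "prob_space ?\<gamma>"
    by (intro N.prob_space_distr) measurable
  show "sets ?\<gamma> = sets borel"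
    by simp
  fix x :: 'a
  have *: "complex_of_real (x \<bullet> (\<Sum>b\<in>Basis. (f b / \<sigma>) *\<^sub>R b)) = (\<Sum>b\<in>Basis. (x \<bullet> b / \<sigma>) * f b)" for f :: "'a \<Rightarrow> real"
    by (simp add: inner_sum_right mult.commute)
  interpret \<gamma>: prob_space ?\<gamma> by fact
  \<comment> \<open>The complex exponential, unlike the cosine, factors over the coordinates; the
    real part is taken only at the end.\<close>
  have "(LINT \<xi>|?\<gamma>. cis (x \<bullet> \<xi>)) = (LINT f|?P. (\<Prod>b\<in>Basis. iexp ((x \<bullet> b / \<sigma>) * f b)))"
    by (subst integral_distr) (auto simp: cis_conv_exp * sum_distrib_left exp_sum)
  also have "\<dots> = (\<Prod>b\<in>Basis. char std_normal_distribution (x \<bullet> b / \<sigma>))"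
    unfolding char_def
    by (intro N.product_integral_prod finite_Basis S.integrable_const_bound[of _ 1])
      (simp_all add: norm_exp_eq_Re)
  also have "\<dots> = exp (\<Sum>b\<in>Basis. - ((x \<bullet> b / \<sigma>)\<^sup>2 / 2))"
    by (simp add: char_std_normal_distribution exp_sum)
  also have "(\<Sum>b\<in>Basis. - ((x \<bullet> b / \<sigma>)\<^sup>2 / 2)) = - ((norm x)\<^sup>2 / (2 * \<sigma>\<^sup>2))"
    unfolding power2_norm_eq_inner euclidean_inner[of x x]
    by (simp add: sum_negf sum_divide_distrib power2_eq_square field_simps)
  finally have "(LINT \<xi>|?\<gamma>. cis (x \<bullet> \<xi>)) = complex_of_real (exp (- ((norm x)\<^sup>2 / (2 * \<sigma>\<^sup>2))))" .
  then have "Re (LINT \<xi>|?\<gamma>. cis (x \<bullet> \<xi>)) = exp (- ((norm x)\<^sup>2 / (2 * \<sigma>\<^sup>2)))"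
    by (simp only: Re_complex_of_real)
  moreover have "Re (LINT \<xi>|?\<gamma>. cis (x \<bullet> \<xi>)) = (LINT \<xi>|?\<gamma>. Re (cis (x \<bullet> \<xi>)))"
    by (rule integral_Re[symmetric]) (auto intro!: \<gamma>.integrable_const_bound[of _ 1] simp: cis_conv_exp)
  ultimately show "(LINT \<xi>|?\<gamma>. cos (x \<bullet> \<xi>)) = exp (- ((norm x)\<^sup>2 / (2 * \<sigma>\<^sup>2)))"
    by simp
qed

section \<open>The dyadic decomposition of the tail\<close>

text \<open>This is the m-th power of \<open>x / m \<le> exp (x / m)\<close>, inverted. It trades
  exponential smallness for a power of any prescribed order.\<close>

lemma exp_minus_le_powr:
  fixes x m :: real
  assumes "0 < x" "0 < m"
  shows "exp (- x) \<le> (m / x) powr m"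
proof -
  have "x / m \<le> exp (x / m)"
    using exp_ge_add_one_self[of "x / m"] by linarith
  then have "(x / m) powr m \<le> exp (x / m) powr m"
    using assms by (intro powr_mono2) auto
  also have "\<dots> = exp x"
    using assms by (simp add: powr_def)
  finally have "inverse (exp x) \<le> inverse ((x / m) powr m)"
    using assms by (intro le_imp_inverse_le) auto
  also have "inverse ((x / m) powr m) = (m / x) powr m"
    using assms by (metis inverse_divide inverse_powr less_imp_le)
  finally show ?thesis
    by (simp add: exp_minus)
qed

text \<open>
  Bounds the probability of no jump on the annuli of index below \<open>i\<close>, by keeping only the
  contribution of the annulus \<open>i - 1\<close>.
\<close>

definition level_weight :: "real \<Rightarrow> real \<Rightarrow> nat \<Rightarrow> real" where
  "level_weight c \<alpha> i = (if i = 0 then 1 else exp (- c * 2 powr (real (i - 1) * \<alpha>)))"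

lemma summable_level_weight:
  assumes "0 < c" "0 < \<alpha>"
  shows "summable (\<lambda>i. 2 ^ (i * N) * level_weight c \<alpha> i)"
proof (rule summable_comparison_test'[where N = 1])
  \<comment> \<open>With this order the double exponential is replaced by a constant times
    2^(-(i-1)(N+1)), which cancels 2^(i N) and leaves a geometric series of ratio 1/2.\<close>
  define m where "m = (real N + 1) / \<alpha>"
  have m: "0 < m" "m * \<alpha> = real N + 1"
    using assms by (auto simp: m_def)
  show "summable (\<lambda>i. (m / c) powr m * 2 ^ (N + 1) * (1 / 2) ^ i)"
    by (intro summable_mult summable_geometric) auto
  fix i :: nat
  assume i: "1 \<le> i"
  have "exp (- (c * 2 powr (real (i - 1) * \<alpha>))) \<le> (m / (c * 2 powr (real (i - 1) * \<alpha>))) powr m"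
    using assms m by (intro exp_minus_le_powr) auto
  also have "\<dots> = (m / c) powr m / (2 powr (real (i - 1) * \<alpha>)) powr m"
    using assms m by (simp add: powr_divide powr_mult)
  also have "(2 powr (real (i - 1) * \<alpha>)) powr m = 2 powr (real ((i - 1) * (N + 1)))"
    using m by (simp add: powr_powr mult.assoc mult.commute[of \<alpha>] distrib_left add.commute)
  also have "\<dots> = 2 ^ ((i - 1) * (N + 1))"
    by (rule powr_realpow) simp
  finally have "2 ^ (i * N) * exp (- (c * 2 powr (real (i - 1) * \<alpha>)))
      \<le> 2 ^ (i * N) * ((m / c) powr m / 2 ^ ((i - 1) * (N + 1)))"
    by (intro mult_left_mono) auto
  also have "\<dots> = (m / c) powr m * 2 ^ (N + 1) * (1 / 2) ^ i"
  proof -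
    obtain k where k: "i = Suc k"
      using i by (cases i) auto
    have "(2::real) ^ (i * N) * 2 ^ i = 2 ^ (N + 1) * 2 ^ ((i - 1) * (N + 1))"
      unfolding k power_add[symmetric] by (simp add: algebra_simps)
    then show ?thesis
      by (simp add: field_simps power_divide)
  qed
  finally show "norm (2 ^ (i * N) * level_weight c \<alpha> i) \<le> (m / c) powr m * 2 ^ (N + 1) * (1 / 2) ^ i"
    using i by (simp add: level_weight_def)
qed

definition annulus :: "real \<Rightarrow> 'a::euclidean_space set" where
  "annulus r = {z. r \<le> norm z \<and> norm z < 2 * r}"

definition annulus_vol :: "'a::euclidean_space itself \<Rightarrow> real" where
  "annulus_vol _ = (2 ^ DIM('a) - 1) * unit_ball_vol (real DIM('a))"

lemma annulus_vol_pos: "0 < annulus_vol TYPE('a::euclidean_space)"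
  by (simp add: annulus_vol_def)

lemma measurable_annulus [measurable]: "annulus r \<in> sets borel"
  unfolding annulus_def by measurable

lemma emeasure_annulus:
  assumes "0 < r"
  shows "emeasure lborel (annulus r :: 'a::euclidean_space set) = ennreal (annulus_vol TYPE('a) * r ^ DIM('a))"
proof -
  have eq: "annulus r = ball (0::'a) (2 * r) - ball 0 r"
    by (auto simp: annulus_def)
  have "emeasure lborel (annulus r :: 'a set) = emeasure lborel (ball (0::'a) (2 * r)) - emeasure lborel (ball (0::'a) r)"
    unfolding eq using assms by (intro emeasure_Diff) (auto simp: emeasure_ball)
  also have "\<dots> = ennreal (unit_ball_vol (real DIM('a)) * (2 * r) ^ DIM('a) - unit_ball_vol (real DIM('a)) * r ^ DIM('a))"
    using assms by (simp add: emeasure_ball ennreal_minus)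
  also have "unit_ball_vol (real DIM('a)) * (2 * r) ^ DIM('a) - unit_ball_vol (real DIM('a)) * r ^ DIM('a)
      = annulus_vol TYPE('a) * r ^ DIM('a)"
    by (simp add: annulus_vol_def power_mult_distrib algebra_simps)
  finally show ?thesis .
qed

text \<open>One step makes a split-off jump into annulus i with probability \<open>a i\<close>,
  which is proportional to 1/n. Avoiding it for n steps therefore has probability at most (1 - a
  i)^n \<le> exp (- n a i), a bound free of n. The function \<open>g\<close> is the walk with all
  these jumps removed; only its total mass is controlled. The assumption \<open>n_large\<close>
  switches off the cap in \<open>small_step\<close> on all of \<open>R \<le> norm z\<close>.\<close>

lemma walk_small_step_bound:
  fixes J :: "'a::euclidean_space \<Rightarrow> real" and t \<alpha> c0 R :: real and f :: "'a \<Rightarrow> ennreal"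
  assumes J_meas [measurable]: "J \<in> borel_measurable borel"
    and J_nonneg: "\<And>z. 0 \<le> J z"
    and J_even: "\<And>z. J (- z) = J z"
    and J_int: "integrable lborel (\<lambda>z. J z * min ((norm z)\<^sup>2) 1)"
    and pos: "0 < t" "0 < \<alpha>" "0 < c0" "0 < R"
    and J_lower: "\<And>z. R \<le> norm z \<Longrightarrow> c0 * norm z powr (- real DIM('a) - \<alpha>) \<le> J z"
    and t_large: "R \<le> t powr (1 / \<alpha>)"
    and n_large: "t * ((LINT y|lborel. J y * min ((norm y)\<^sup>2) 1) + 1) \<le> real n * min (R\<^sup>2) 1"
    and f_meas [measurable]: "f \<in> borel_measurable borel"
  defines "V \<equiv> annulus_vol TYPE('a)"
  defines "c1 \<equiv> c0 * 2 powr (- real DIM('a) - \<alpha>) * V"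
  defines "S \<equiv> (\<Sum>i. 2 ^ (i * DIM('a)) * level_weight c1 \<alpha> i)"
  shows "\<exists>g \<in> borel_measurable borel.
    (\<forall>x. (walk (ennreal (1 - (LINT z|lborel. small_step J t n z))) (\<lambda>z. ennreal (small_step J t n z)) ^^ n) f x
       \<le> g x + ennreal (S / V * t powr (- (real DIM('a) / \<alpha>))) * (\<integral>\<^sup>+x. f x \<partial>lborel)) \<and>
    (\<integral>\<^sup>+x. g x \<partial>lborel) \<le> ennreal (exp (- (c1 * (2 * R) powr (- \<alpha>)) * t)) * (\<integral>\<^sup>+x. f x \<partial>lborel)"
proof -
  let ?N = "DIM('a)"
  note ss_meas [measurable] = measurable_small_step[OF J_meas J_nonneg J_even J_int pos(1)]
  note ss_nonneg = small_step_nonneg[OF J_meas J_nonneg J_even J_int pos(1)]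
  note ss_int = integrable_small_step[OF J_meas J_nonneg J_even J_int pos(1)]
  note ss_mass = small_step_mass[OF J_meas J_nonneg J_even J_int pos(1)]
  have V: "0 < V"
    by (simp add: V_def annulus_vol_pos)
  have c1: "0 < c1"
    using pos V by (simp add: c1_def)
  have n: "0 < real n"
  proof (rule ccontr)
    assume "\<not> 0 < real n"
    then have "t * ((LINT y|lborel. J y * min ((norm y)\<^sup>2) 1) + 1) \<le> 0"
      using n_large by simp
    moreover have "0 < t * ((LINT y|lborel. J y * min ((norm y)\<^sup>2) 1) + 1)"
      using J_mass_nonneg[OF J_meas J_nonneg J_even J_int pos(1)] pos by (intro mult_pos_pos) (auto intro: add_nonneg_pos)
    ultimately show False by simp
  qed
  define r where "r i = t powr (1 / \<alpha>) / 2 ^ i" for i :: nat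
  have r_pos: "0 < r i" for i
    using pos by (simp add: r_def)
  have r_anti: "r j \<le> r i" if "i \<le> j" for i j
    using that pos by (auto simp: r_def intro!: divide_left_mono power_increasing)
  have r_Suc: "r (Suc i) = r i / 2" for i
    by (simp add: r_def)
  \<comment> \<open>The last radius still above \<open>R\<close>. It exists because
    \<open>t_large\<close> says that \<open>r 0\<close> qualifies.\<close>
  obtain k where k: "R \<le> r k" "r k < 2 * R"
  proof -
    obtain i where "(1 / 2) ^ i < R / t powr (1 / \<alpha>)"
      using real_arch_pow_inv[of "R / t powr (1 / \<alpha>)" "1 / 2"] pos by auto
    then have ex: "\<exists>i. r i < R"
      using pos by (auto simp: r_def field_simps intro!: exI[of _ i])
    define i0 where "i0 = (LEAST i. r i < R)"
    have i0: "r i0 < R"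
      unfolding i0_def using ex by (rule LeastI_ex)
    have "i0 \<noteq> 0"
      using i0 t_large by (intro notI) (simp add: r_def)
    then obtain k where "i0 = Suc k"
      by (cases i0) auto
    moreover from this have "\<not> r k < R"
      using not_less_Least[of k "\<lambda>i. r i < R"] by (simp add: i0_def)
    ultimately show ?thesis
      using that[of k] i0 by (simp add: r_Suc)
  qed
  define K where "K = Suc k"
  \<comment> \<open>On annulus i the norm is below \<open>2 * r i\<close>, so the lower bound on
    \<open>J\<close> at that radius is a height available on the whole annulus. Constant heights
    make each \<open>H i\<close> a multiple of a uniform density.\<close>
  define h where "h i = t / real n * (c0 * (2 * r i) powr (- real ?N - \<alpha>))" for i
  define H where "H i z = h i * indicator (annulus (r i)) z" for i and z :: 'a
  define b where "b z = small_step J t n z - (\<Sum>i<K. H i z)" for z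
  define a where "a i = c1 * t * r i powr (- \<alpha>) / real n" for i
  define D where "D i = 1 / (V * r i ^ ?N)" for i
  define w where "w = 1 - (LINT z|lborel. small_step J t n z)"
  have h0: "0 \<le> h i" for i
    using pos n by (simp add: h_def)
  have H0: "0 \<le> H i z" for i z
    using h0 by (simp add: H_def)
  have w0: "0 \<le> w"
    using ss_mass by (simp add: w_def)
  have [measurable]: "H i \<in> borel_measurable borel" for i
    unfolding H_def by measurable
  have [measurable]: "b \<in> borel_measurable borel"
    unfolding b_def by measurable
  have ha: "h i * (V * r i ^ ?N) = a i" for i
  proof -
    have "(2 * r i) powr (- real ?N - \<alpha>) * r i ^ ?N
        = 2 powr (- real ?N - \<alpha>) * (r i powr (- real ?N - \<alpha>) * r i powr (real ?N))"
      using r_pos[of i] by (simp add: powr_mult powr_realpow)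
    also have "r i powr (- real ?N - \<alpha>) * r i powr (real ?N) = r i powr (- \<alpha>)"
      by (simp add: powr_add[symmetric])
    finally show ?thesis
      by (simp add: h_def a_def c1_def field_simps)
  qed
  have a0: "0 \<le> a i" for i
    using c1 pos by (simp add: a_def)
  have H_nn: "(\<integral>\<^sup>+z. ennreal (H i z) \<partial>lborel) = ennreal (a i)" for i
  proof -
    have "(\<integral>\<^sup>+z. ennreal (H i z) \<partial>lborel) = (\<integral>\<^sup>+z. ennreal (h i) * indicator (annulus (r i) :: 'a set) z \<partial>lborel)"
      using h0[of i] by (simp add: H_def ennreal_mult ennreal_indicator)
    also have "\<dots> = ennreal (h i) * ennreal (V * r i ^ ?N)"
      using r_pos[of i] by (simp add: nn_integral_cmult_indicator emeasure_annulus V_def)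
    also have "\<dots> = ennreal (a i)"
      using h0[of i] V r_pos[of i] by (simp add: ennreal_mult[symmetric] ha)
    finally show ?thesis .
  qed
  have b0: "0 \<le> b z" for z
  proof (cases "\<exists>i<K. z \<in> annulus (r i)")
    case True
    then obtain i where i: "i < K" "z \<in> annulus (r i)"
      by blast
    \<comment> \<open>Since the radii halve, the annuli are disjoint, so only one height has to be
      subtracted at each point.\<close>
    have other: "z \<notin> annulus (r j)" if "j \<noteq> i" for j
    proof
      assume j: "z \<in> annulus (r j)"
      consider "Suc i \<le> j" | "Suc j \<le> i"
        using \<open>j \<noteq> i\<close> by linarith
      then show False
      proof cases
        case 1
        then have "2 * r j \<le> r i"
          using r_anti[OF 1] by (simp add: r_Suc)
        then show False
          using i j by (simp add: annulus_def)
      next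
        case 2
        then have "2 * r i \<le> r j"
          using r_anti[OF 2] by (simp add: r_Suc)
        then show False
          using i j by (simp add: annulus_def)
      qed
    qed
    have "(\<Sum>i<K. H i z) = (\<Sum>j<K. if j = i then h i else 0)"
      using other i by (intro sum.cong) (auto simp: H_def)
    also have "\<dots> = h i"
      using i by simp
    finally have sum: "(\<Sum>i<K. H i z) = h i" .
    have "R \<le> r i"
      using r_anti[of i k] i k by (simp add: K_def)
    with i have z: "R \<le> norm z" "norm z \<le> 2 * r i"
      by (auto simp: annulus_def)
    have "min (R\<^sup>2) 1 \<le> min ((norm z)\<^sup>2) 1"
      using z pos by (intro min.mono power_mono) auto
    then have "real n * min (R\<^sup>2) 1 \<le> real n * min ((norm z)\<^sup>2) 1"
      by (rule mult_left_mono) simp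
    with n_large have ss: "small_step J t n z = t / real n * J z"
      by (intro small_step_eq[OF J_meas J_nonneg J_even J_int pos(1)]) simp
    have "(2 * r i) powr (- real ?N - \<alpha>) \<le> norm z powr (- real ?N - \<alpha>)"
      using z pos by (intro powr_mono2') auto
    then have "c0 * (2 * r i) powr (- real ?N - \<alpha>) \<le> J z"
      using J_lower[OF z(1)] pos by (meson mult_left_mono less_imp_le order_trans)
    then have "h i \<le> small_step J t n z"
      unfolding h_def ss using pos by (intro mult_left_mono) auto
    then show ?thesis
      by (simp add: b_def sum)
  next
    case False
    then have "(\<Sum>i<K. H i z) = 0"
      by (intro sum.neutral) (auto simp: H_def)
    then show ?thesis
      using ss_nonneg by (simp add: b_def)
  qed
  have decomp: "ennreal (small_step J t n z) = ennreal (b z) + (\<Sum>i<K. ennreal (H i z))" for z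
    using b0 H0 by (simp add: sum_ennreal sum_nonneg ennreal_plus[symmetric] b_def del: ennreal_plus)
  have total: "ennreal w + (\<integral>\<^sup>+z. ennreal (b z) + (\<Sum>i<K. ennreal (H i z)) \<partial>lborel) = 1"
  proof -
    have "(\<integral>\<^sup>+z. ennreal (small_step J t n z) \<partial>lborel) = ennreal (LINT z|lborel. small_step J t n z)"
      using ss_nonneg by (intro nn_integral_eq_integral ss_int) auto
    moreover have "0 \<le> (LINT z|lborel. small_step J t n z)"
      using ss_nonneg by (intro integral_nonneg_AE) auto
    ultimately show ?thesis
      using w0 unfolding decomp[symmetric] by (simp add: ennreal_plus[symmetric] w_def del: ennreal_plus)
  qed
  define s where "s i = ennreal w + (\<integral>\<^sup>+z. ennreal (b z) + (\<Sum>j\<in>{i..<K}. ennreal (H j z)) \<partial>lborel)" for i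
  have s_eq: "s i = ennreal w + (\<integral>\<^sup>+z. ennreal (b z) \<partial>lborel) + (\<Sum>j\<in>{i..<K}. ennreal (a j))" for i
    unfolding s_def by (simp add: nn_integral_add nn_integral_sum H_nn add.assoc)
  have s0: "s 0 = 1"
    using total by (simp add: s_def atLeast0LessThan)
  \<comment> \<open>Only the component i is taken into account:
    \<open>s (Suc i) = s i - a i \<le> 1 - a i \<le> exp (- a i)\<close>, and the n-th power cancels
    the 1/n in \<open>a i\<close>.\<close>
  have s_Suc: "s (Suc i) ^ n \<le> ennreal (exp (- c1 * t * r i powr (- \<alpha>)))" if "i < K" for i
  proof -
    have split: "s i = s (Suc i) + ennreal (a i)"
      using that unfolding s_eq by (simp add: sum.atLeast_Suc_lessThan[of i K] add_ac)
    have le1: "s i \<le> 1"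
    proof -
      have "(\<Sum>j\<in>{i..<K}. ennreal (a j)) \<le> (\<Sum>j\<in>{0..<K}. ennreal (a j))"
        by (intro sum_mono2) auto
      then have "s i \<le> s 0"
        unfolding s_eq by (intro add_left_mono)
      then show ?thesis
        by (simp add: s0)
    qed
    then obtain u where u: "s (Suc i) = ennreal u" "0 \<le> u"
      using split by (cases "s (Suc i)") (auto simp: top_unique)
    then have "u + a i \<le> 1"
      using le1 a0[of i] split by (simp add: ennreal_plus[symmetric] del: ennreal_plus)
    then have "u \<le> exp (- a i)"
      using exp_ge_add_one_self[of "- a i"] by linarith
    then have "u ^ n \<le> exp (- a i) ^ n"
      using u by (intro power_mono)
    also have "exp (- a i) ^ n = exp (- c1 * t * r i powr (- \<alpha>))"
      using n by (simp add: exp_of_nat_mult[symmetric] a_def)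
    finally show ?thesis
      using u by (simp add: ennreal_power)
  qed
  \<comment> \<open>This is where the choice of \<open>t powr (1 / \<alpha>)\<close> as largest
    radius pays: the exponents in \<open>s_Suc\<close> become independent of t.\<close>
  have r_powr: "t * r i powr (- \<alpha>) = 2 powr (real i * \<alpha>)" for i
  proof -
    have "r i powr (- \<alpha>) = (t powr (1 / \<alpha>)) powr (- \<alpha>) / (2 ^ i) powr (- \<alpha>)"
      using pos by (simp add: r_def powr_divide)
    also have "(t powr (1 / \<alpha>)) powr (- \<alpha>) = 1 / t"
      using pos by (simp add: powr_powr powr_minus_divide)
    also have "(2 ^ i) powr (- \<alpha>) = 1 / 2 powr (real i * \<alpha>)"
      by (simp add: powr_realpow[symmetric] powr_powr powr_minus_divide)
    finally show ?thesis
      using pos by simp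
  qed
  have lw: "s i ^ n \<le> ennreal (level_weight c1 \<alpha> i)" if "i < K" for i
  proof (cases i)
    case 0
    then show ?thesis by (simp add: s0 level_weight_def)
  next
    case (Suc j)
    then show ?thesis
      using s_Suc[of j] that by (simp add: level_weight_def mult.assoc r_powr)
  qed
  have D_eq: "D i = 2 ^ (i * ?N) / V * t powr (- (real ?N / \<alpha>))" for i
  proof -
    have "r i ^ ?N = (t powr (1 / \<alpha>)) ^ ?N / 2 ^ (i * ?N)"
      by (simp add: r_def power_divide power_mult)
    also have "(t powr (1 / \<alpha>)) ^ ?N = t powr (real ?N / \<alpha>)"
      using pos by (simp add: powr_realpow[symmetric] powr_powr)
    finally show ?thesis
      by (simp add: D_def powr_minus_divide)
  qed
  have D0: "0 \<le> D i" for i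
    using V by (simp add: D_eq)
  have sum_le: "(\<Sum>i<K. ennreal (D i) * s i ^ n) \<le> ennreal (S / V * t powr (- (real ?N / \<alpha>)))"
  proof -
    have "(\<Sum>i<K. ennreal (D i) * s i ^ n) \<le> (\<Sum>i<K. ennreal (D i * level_weight c1 \<alpha> i))"
    proof (rule sum_mono)
      fix i assume "i \<in> {..<K}"
      then have "ennreal (D i) * s i ^ n \<le> ennreal (D i) * ennreal (level_weight c1 \<alpha> i)"
        using lw[of i] by (intro mult_left_mono) auto
      then show "ennreal (D i) * s i ^ n \<le> ennreal (D i * level_weight c1 \<alpha> i)"
        by (simp add: D0 ennreal_mult level_weight_def)
    qed
    also have "\<dots> = ennreal (\<Sum>i<K. D i * level_weight c1 \<alpha> i)"
      using D0 by (intro sum_ennreal) (simp add: level_weight_def)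
    also have "(\<Sum>i<K. D i * level_weight c1 \<alpha> i)
        = (\<Sum>i<K. 2 ^ (i * ?N) * level_weight c1 \<alpha> i) / V * t powr (- (real ?N / \<alpha>))"
      unfolding D_eq sum_divide_distrib sum_distrib_right by (rule sum.cong) (simp_all add: mult_ac)
    also have "ennreal \<dots> \<le> ennreal (S / V * t powr (- (real ?N / \<alpha>)))"
    proof (intro ennreal_leI mult_right_mono divide_right_mono)
      show "(\<Sum>i<K. 2 ^ (i * ?N) * level_weight c1 \<alpha> i) \<le> S"
        unfolding S_def using summable_level_weight[OF c1 pos(2), of ?N]
        by (intro sum_le_suminf) (auto simp: level_weight_def)
    qed (use V in auto)
    finally show ?thesis .
  qed
  define I where "I = (\<integral>\<^sup>+x. f x \<partial>lborel)"
  show ?thesis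
  proof (intro bexI conjI allI)
    let ?g = "(walk (ennreal w) (\<lambda>z. ennreal (b z)) ^^ n) f"
    show "?g \<in> borel_measurable borel"
      by measurable
    fix x
    have "(walk (ennreal w) (\<lambda>z. ennreal (small_step J t n z)) ^^ n) f x
        \<le> ?g x + (\<Sum>i<K. ennreal (D i) * s i ^ n) * I"
      unfolding decomp s_def I_def
    proof (rule walk_funpow_split_sum)
      fix i z
      have "h i = D i * a i"
        using V r_pos[of i] by (simp add: D_def ha[symmetric])
      then have "ennreal (h i) = ennreal (D i) * (\<integral>\<^sup>+z. ennreal (H i z) \<partial>lborel)"
        using D0 a0 by (simp add: H_nn ennreal_mult)
      moreover have "ennreal (H i z) \<le> ennreal (h i)"
        using h0[of i] by (intro ennreal_leI) (auto simp: H_def indicator_def)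
      ultimately show "ennreal (H i z) \<le> ennreal (D i) * (\<integral>\<^sup>+z. ennreal (H i z) \<partial>lborel)"
        by simp
    qed measurable
    also have "\<dots> \<le> ?g x + ennreal (S / V * t powr (- (real ?N / \<alpha>))) * I"
      using sum_le by (intro add_left_mono mult_right_mono) auto
    finally show "(walk (ennreal (1 - (LINT z|lborel. small_step J t n z))) (\<lambda>z. ennreal (small_step J t n z)) ^^ n) f x
       \<le> ?g x + ennreal (S / V * t powr (- (real ?N / \<alpha>))) * (\<integral>\<^sup>+x. f x \<partial>lborel)"
      by (simp add: w_def I_def)
    \<comment> \<open>The smallest annulus alone gives the exponential rate, because
      \<open>r k < 2 * R\<close> bounds its hitting rate from below independently of t.\<close>
    have "(\<integral>\<^sup>+x. ?g x \<partial>lborel) = s K ^ n * I"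
      by (simp add: nn_integral_walk_funpow s_def I_def)
    also have "\<dots> \<le> ennreal (exp (- c1 * t * r k powr (- \<alpha>))) * I"
      using s_Suc[of k] by (intro mult_right_mono) (auto simp: K_def)
    also have "\<dots> \<le> ennreal (exp (- (c1 * (2 * R) powr (- \<alpha>)) * t)) * I"
    proof (intro mult_right_mono ennreal_leI)
      have "(2 * R) powr (- \<alpha>) \<le> r k powr (- \<alpha>)"
        using k pos by (intro powr_mono2') auto
      then have "c1 * t * (2 * R) powr (- \<alpha>) \<le> c1 * t * r k powr (- \<alpha>)"
        using c1 pos by (intro mult_left_mono) auto
      then show "exp (- c1 * t * r k powr (- \<alpha>)) \<le> exp (- (c1 * (2 * R) powr (- \<alpha>)) * t)"
        by (simp add: mult_ac)
    qed simp
    finally show "(\<integral>\<^sup>+x. ?g x \<partial>lborel) \<le> ennreal (exp (- (c1 * (2 * R) powr (- \<alpha>)) * t)) * (\<integral>\<^sup>+x. f x \<partial>lborel)"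
      by (simp add: I_def)
  qed
qed

section \<open>Concentration bounds for the heat measure\<close>

text \<open>The Gaussian is left unnormalised: with maximum 1 it is the cosine transform of a
  probability measure. Its integral is carried as a factor on both sides and cancelled.\<close>

definition bump :: "real \<Rightarrow> 'a::euclidean_space \<Rightarrow> real" where
  "bump \<sigma> x = exp (- ((norm x)\<^sup>2 / (2 * \<sigma>\<^sup>2)))"

lemma measurable_bump [measurable]: "bump \<sigma> \<in> borel_measurable borel"
  unfolding bump_def by measurable

lemma bump_nonneg: "0 \<le> bump \<sigma> x"
  by (simp add: bump_def)

lemma bump_le_1: "bump \<sigma> x \<le> 1"
  by (simp add: bump_def)

lemma bump_scale: "\<sigma> \<noteq> 0 \<Longrightarrow> bump \<sigma> (\<sigma> *\<^sub>R z) = bump 1 z"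
  by (simp add: bump_def power_mult_distrib)

lemma nn_integral_lborel_scale:
  fixes F :: "'a::euclidean_space \<Rightarrow> ennreal"
  assumes [measurable]: "F \<in> borel_measurable borel" and "0 < \<sigma>"
  shows "(\<integral>\<^sup>+x. F x \<partial>lborel) = ennreal (\<sigma> ^ DIM('a)) * (\<integral>\<^sup>+z. F (\<sigma> *\<^sub>R z) \<partial>lborel)"
  using \<open>0 < \<sigma>\<close>
  by (subst lborel_affine[of \<sigma> 0]) (simp_all add: nn_integral_density nn_integral_distr nn_integral_cmult)

lemma nn_integral_bump:
  "(\<integral>\<^sup>+x. ennreal (bump 1 x) \<partial>(lborel :: 'a::euclidean_space measure)) = ennreal (sqrt (2 * pi) ^ DIM('a))"
proof -
  interpret N: prob_space std_normal_distribution
    by (rule prob_space_normal_density) simp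
  have "(\<integral>\<^sup>+u. ennreal (exp (- (u\<^sup>2 / 2))) \<partial>lborel) = (\<integral>\<^sup>+u. ennreal (sqrt (2 * pi)) * ennreal (std_normal_density u) \<partial>lborel)"
    by (intro nn_integral_cong) (simp add: std_normal_density_def ennreal_mult[symmetric])
  also have "\<dots> = ennreal (sqrt (2 * pi)) * emeasure std_normal_distribution (space std_normal_distribution)"
    by (simp add: nn_integral_cmult emeasure_density)
  also have "\<dots> = ennreal (sqrt (2 * pi))"
    by (simp only: N.emeasure_space_1) simp
  finally have 1: "(\<integral>\<^sup>+u. ennreal (exp (- (u\<^sup>2 / 2))) \<partial>lborel) = ennreal (sqrt (2 * pi))" .
  have "ennreal (bump 1 x) = (\<Prod>b\<in>Basis. ennreal (exp (- ((x \<bullet> b)\<^sup>2 / 2))))" for x :: 'a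
  proof -
    have "- ((norm x)\<^sup>2 / 2) = (\<Sum>b\<in>Basis. - ((x \<bullet> b)\<^sup>2 / 2))"
      unfolding power2_norm_eq_inner euclidean_inner[of x x]
      by (simp add: sum_negf sum_divide_distrib power2_eq_square)
    then show ?thesis
      by (simp add: bump_def exp_sum prod_ennreal)
  qed
  then have "(\<integral>\<^sup>+x. ennreal (bump 1 x) \<partial>(lborel :: 'a measure))
      = (\<integral>\<^sup>+x. (\<Prod>b\<in>Basis. ennreal (exp (- ((x \<bullet> b)\<^sup>2 / 2)))) \<partial>(lborel :: 'a measure))"
    by simp
  also have "\<dots> = (\<Prod>b\<in>(Basis :: 'a set). (\<integral>\<^sup>+u. ennreal (exp (- (u\<^sup>2 / 2))) \<partial>lborel))"
    by (rule nn_integral_lborel_prod) auto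
  also have "\<dots> = ennreal (sqrt (2 * pi) ^ DIM('a))"
    by (simp add: 1 ennreal_power)
  finally show ?thesis .
qed

text \<open>Let the width of the Gaussian tend to 0. For open U and y in U the points y + \<sigma> z
  are eventually in U, so Fatou recovers \<open>emeasure \<mu> U\<close> from below, the direction
  needed. Outer regularity of Lebesgue measure then carries the bound to Borel sets;
  \<open>M < top\<close> keeps the error \<open>M * emeasure lborel (U - E)\<close> small.\<close>

lemma measure_bound_of_smoothed:
  fixes \<mu> :: "'a::euclidean_space measure" and M \<eta> :: ennreal
  assumes \<mu>: "prob_space \<mu>" "sets \<mu> = sets borel" and "M < top"
    and smoothed: "\<And>U \<sigma>. open U \<Longrightarrow> 0 < \<sigma> \<Longrightarrow>
      (\<integral>\<^sup>+x. indicator U x * (\<integral>\<^sup>+y. ennreal (bump \<sigma> (x - y)) \<partial>\<mu>) \<partial>lborel)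
        \<le> (M * emeasure lborel U + \<eta>) * (\<integral>\<^sup>+x. ennreal (bump \<sigma> (x :: 'a)) \<partial>lborel)"
    and E: "E \<in> sets borel"
  shows "emeasure \<mu> E \<le> M * emeasure lborel E + \<eta>"
proof -
  interpret prob_space \<mu> by fact
  note [measurable_cong] = \<mu>(2)
  interpret P: pair_sigma_finite lborel \<mu> ..
  define I where "I = (\<integral>\<^sup>+x. ennreal (bump 1 (x :: 'a)) \<partial>lborel)"
  have I: "I \<noteq> 0" "I \<noteq> top"
    by (simp_all add: I_def nn_integral_bump)
  have open_bound: "emeasure \<mu> U \<le> M * emeasure lborel U + \<eta>" if "open U" for U
  proof -
    have [measurable]: "U \<in> sets borel"
      using that by simp
    \<comment> \<open>The substitution x = y + \<sigma> z moves \<sigma> from the weight into the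
      indicator, so that Fatou can be applied against a fixed Gaussian; the Jacobian
      cancels.\<close>
    have scaled: "(\<integral>\<^sup>+y. (\<integral>\<^sup>+z. indicator U (y + \<sigma> *\<^sub>R z) * ennreal (bump 1 z) \<partial>lborel) \<partial>\<mu>)
        \<le> (M * emeasure lborel U + \<eta>) * I" if "0 < \<sigma>" for \<sigma>
    proof -
      have "(\<integral>\<^sup>+x. indicator U x * (\<integral>\<^sup>+y. ennreal (bump \<sigma> (x - y)) \<partial>\<mu>) \<partial>lborel)
          = (\<integral>\<^sup>+x. (\<integral>\<^sup>+y. indicator U x * ennreal (bump \<sigma> (x - y)) \<partial>\<mu>) \<partial>lborel)"
        by (simp add: nn_integral_cmult)
      also have "\<dots> = (\<integral>\<^sup>+y. (\<integral>\<^sup>+x. indicator U x * ennreal (bump \<sigma> (x - y)) \<partial>lborel) \<partial>\<mu>)"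
        by (rule P.Fubini'[symmetric]) measurable
      also have "\<dots> = (\<integral>\<^sup>+y. (\<integral>\<^sup>+x. indicator U (x + y) * ennreal (bump \<sigma> x) \<partial>lborel) \<partial>\<mu>)"
      proof (rule nn_integral_cong)
        fix y
        show "(\<integral>\<^sup>+x. indicator U x * ennreal (bump \<sigma> (x - y)) \<partial>lborel)
            = (\<integral>\<^sup>+x. indicator U (x + y) * ennreal (bump \<sigma> x) \<partial>lborel)"
          using nn_integral_lborel_shift[of "\<lambda>x. indicator U x * ennreal (bump \<sigma> (x - y))" y] by simp
      qed
      also have "\<dots> = (\<integral>\<^sup>+y. ennreal (\<sigma> ^ DIM('a)) *
          (\<integral>\<^sup>+z. indicator U (y + \<sigma> *\<^sub>R z) * ennreal (bump 1 z) \<partial>lborel) \<partial>\<mu>)"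
        using that by (intro nn_integral_cong, subst nn_integral_lborel_scale[of _ \<sigma>])
          (auto simp: bump_scale add.commute)
      also have "\<dots> = ennreal (\<sigma> ^ DIM('a)) *
          (\<integral>\<^sup>+y. (\<integral>\<^sup>+z. indicator U (y + \<sigma> *\<^sub>R z) * ennreal (bump 1 z) \<partial>lborel) \<partial>\<mu>)"
        by (rule nn_integral_cmult) measurable
      finally have "ennreal (\<sigma> ^ DIM('a)) *
          (\<integral>\<^sup>+y. (\<integral>\<^sup>+z. indicator U (y + \<sigma> *\<^sub>R z) * ennreal (bump 1 z) \<partial>lborel) \<partial>\<mu>)
        \<le> (M * emeasure lborel U + \<eta>) * (\<integral>\<^sup>+x. ennreal (bump \<sigma> (x :: 'a)) \<partial>lborel)"
        using smoothed[OF \<open>open U\<close> that] by simp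
      also have "(\<integral>\<^sup>+x. ennreal (bump \<sigma> (x :: 'a)) \<partial>lborel) = ennreal (\<sigma> ^ DIM('a)) * I"
        using that by (subst nn_integral_lborel_scale[of _ \<sigma>]) (auto simp: bump_scale I_def)
      finally have "ennreal (\<sigma> ^ DIM('a)) *
          (\<integral>\<^sup>+y. (\<integral>\<^sup>+z. indicator U (y + \<sigma> *\<^sub>R z) * ennreal (bump 1 z) \<partial>lborel) \<partial>\<mu>)
        \<le> ennreal (\<sigma> ^ DIM('a)) * ((M * emeasure lborel U + \<eta>) * I)"
        by (simp add: mult_ac)
      then show ?thesis
        using that by (subst (asm) ennreal_mult_le_mult_iff) auto
    qed
    define F where "F m y = (\<integral>\<^sup>+z. indicator U (y + (1 / real (Suc m)) *\<^sub>R z) * ennreal (bump 1 z) \<partial>lborel)" for m y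
    have [measurable]: "F m \<in> borel_measurable borel" for m
      unfolding F_def by measurable
    have "indicator U y * I \<le> liminf (\<lambda>m. F m y)" for y
    proof -
      have "indicator U y * I = (\<integral>\<^sup>+z. indicator U y * ennreal (bump 1 (z :: 'a)) \<partial>lborel)"
        by (simp add: I_def nn_integral_cmult)
      also have "\<dots> \<le> (\<integral>\<^sup>+z. liminf (\<lambda>m. indicator U (y + (1 / real (Suc m)) *\<^sub>R z) * ennreal (bump 1 z)) \<partial>lborel)"
      proof (rule nn_integral_mono)
        fix z :: 'a
        show "indicator U y * ennreal (bump 1 z)
            \<le> liminf (\<lambda>m. indicator U (y + (1 / real (Suc m)) *\<^sub>R z) * ennreal (bump 1 z))"
        proof (cases "y \<in> U")
          case True
          have "(\<lambda>m. y + (1 / real (Suc m)) *\<^sub>R z) \<longlonglongrightarrow> y + 0 *\<^sub>R z"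
            by (intro tendsto_intros LIMSEQ_Suc[OF lim_1_over_n])
          then have "\<forall>\<^sub>F m in sequentially. y + (1 / real (Suc m)) *\<^sub>R z \<in> U"
            using \<open>open U\<close> True by (intro topological_tendstoD) auto
          then show ?thesis
            by (intro Liminf_bounded) (auto simp: True elim!: eventually_mono)
        qed simp
      qed
      also have "\<dots> \<le> liminf (\<lambda>m. F m y)"
        unfolding F_def by (rule nn_integral_liminf) measurable
      finally show ?thesis .
    qed
    then have "(\<integral>\<^sup>+y. indicator U y * I \<partial>\<mu>) \<le> (\<integral>\<^sup>+y. liminf (\<lambda>m. F m y) \<partial>\<mu>)"
      by (intro nn_integral_mono)
    also have "\<dots> \<le> liminf (\<lambda>m. \<integral>\<^sup>+y. F m y \<partial>\<mu>)"
      by (rule nn_integral_liminf) measurable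
    also have "\<dots> \<le> (M * emeasure lborel U + \<eta>) * I"
      using scaled by (intro Liminf_le) (auto simp: F_def)
    finally have "I * emeasure \<mu> U \<le> I * (M * emeasure lborel U + \<eta>)"
      by (simp add: nn_integral_cmult_indicator \<mu> mult.commute)
    then show ?thesis
      using I by (metis ennreal_mult_le_mult_iff)
  qed
  show ?thesis
  proof (rule ennreal_le_epsilon)
    fix e :: real
    assume "0 < e"
    obtain m where m: "M = ennreal m" "0 \<le> m"
      using \<open>M < top\<close> by (cases M) auto
    \<comment> \<open>The + 1 keeps the tolerance positive when \<open>m = 0\<close>.\<close>
    obtain U where U: "open U" "E \<subseteq> U" "emeasure lborel (U - E) < ennreal (e / (m + 1))"
      using outer_regular_lborel[OF E, of "e / (m + 1)"] \<open>0 < e\<close> m by auto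
    have "emeasure \<mu> E \<le> emeasure \<mu> U"
      using U E \<mu> by (intro emeasure_mono) auto
    also have "\<dots> \<le> M * emeasure lborel U + \<eta>"
      by (rule open_bound) fact
    also have "emeasure lborel U = emeasure lborel E + emeasure lborel (U - E)"
      using U E by (subst plus_emeasure) (auto simp: Un_absorb1 Un_Diff_cancel)
    also have "M * (emeasure lborel E + emeasure lborel (U - E)) + \<eta>
        \<le> M * (emeasure lborel E + ennreal (e / (m + 1))) + \<eta>"
      using U by (intro add_right_mono mult_left_mono add_left_mono) auto
    also have "\<dots> = M * emeasure lborel E + \<eta> + ennreal (m * (e / (m + 1)))"
      using m \<open>0 < e\<close> by (simp add: distrib_left ennreal_mult[symmetric] add_ac)
    also have "\<dots> \<le> M * emeasure lborel E + \<eta> + ennreal e"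
      using m \<open>0 < e\<close> by (intro add_left_mono ennreal_leI) (simp add: field_simps)
    finally show "emeasure \<mu> E \<le> M * emeasure lborel E + \<eta> + ennreal e" .
  qed
qed

text \<open>The constants of \<open>walk_small_step_bound\<close> do not depend on n, so Fatou in n
  transfers the estimate to the Gaussian average of \<open>\<mu>\<close>, and the width of the
  Gaussian is removed by \<open>measure_bound_of_smoothed\<close>.\<close>

lemma heat_measure_bound:
  fixes J :: "'a::euclidean_space \<Rightarrow> real" and t \<alpha> c0 R :: real and \<mu> :: "'a measure"
  assumes J_meas [measurable]: "J \<in> borel_measurable borel"
    and J_nonneg: "\<And>z. 0 \<le> J z"
    and J_even: "\<And>z. J (- z) = J z"
    and J_int: "integrable lborel (\<lambda>z. J z * min ((norm z)\<^sup>2) 1)"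
    and pos: "0 < t" "0 < \<alpha>" "0 < c0" "0 < R"
    and J_lower: "\<And>z. R \<le> norm z \<Longrightarrow> c0 * norm z powr (- real DIM('a) - \<alpha>) \<le> J z"
    and t_large: "R \<le> t powr (1 / \<alpha>)"
    and \<mu>: "prob_space \<mu>" "sets \<mu> = sets borel"
    and cos_\<mu>: "\<And>\<xi>. (LINT x|\<mu>. cos (x \<bullet> \<xi>)) = exp (- (LINT z|lborel. (1 - cos (z \<bullet> \<xi>)) * J z) * t)"
    and sin_\<mu>: "\<And>\<xi>. (LINT x|\<mu>. sin (x \<bullet> \<xi>)) = 0"
    and E: "E \<in> sets borel"
  defines "V \<equiv> annulus_vol TYPE('a)"
  defines "c1 \<equiv> c0 * 2 powr (- real DIM('a) - \<alpha>) * V"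
  defines "S \<equiv> (\<Sum>i. 2 ^ (i * DIM('a)) * level_weight c1 \<alpha> i)"
  shows "emeasure \<mu> E \<le> ennreal (S / V * t powr (- (real DIM('a) / \<alpha>))) * emeasure lborel E
    + ennreal (exp (- (c1 * (2 * R) powr (- \<alpha>)) * t))"
proof (rule measure_bound_of_smoothed[OF \<mu> _ _ E])
  fix U :: "'a set" and \<sigma> :: real
  assume U: "open U" and \<sigma>: "0 < \<sigma>"
  have [measurable]: "U \<in> sets borel"
    using U by simp
  interpret M: prob_space \<mu> by fact
  note [measurable_cong] = \<mu>(2)
  define M where "M = ennreal (S / V * t powr (- (real DIM('a) / \<alpha>)))"
  define \<eta> where "\<eta> = ennreal (exp (- (c1 * (2 * R) powr (- \<alpha>)) * t))"
  define I where "I = (\<integral>\<^sup>+x. ennreal (bump \<sigma> (x :: 'a)) \<partial>lborel)"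
  obtain \<gamma> :: "'a measure" where \<gamma>: "prob_space \<gamma>" "sets \<gamma> = sets borel"
      "\<And>x. (LINT \<xi>|\<gamma>. cos (x \<bullet> \<xi>)) = bump \<sigma> x"
    using gaussian_cos_transform[OF \<sigma>] unfolding bump_def by blast
  define T where "T n x = (walk (ennreal (1 - (LINT z|lborel. small_step J t n z)))
      (\<lambda>z. ennreal (small_step J t n z)) ^^ n) (\<lambda>x. ennreal (bump \<sigma> x)) x" for n x
  note [measurable] = measurable_small_step[OF J_meas J_nonneg J_even J_int pos(1)]
  have [measurable]: "T n \<in> borel_measurable borel" for n
    unfolding T_def by measurable
  have T_lim: "(\<lambda>n. T n x) \<longlonglongrightarrow> (\<integral>\<^sup>+y. ennreal (bump \<sigma> (x - y)) \<partial>\<mu>)" for x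
  proof -
    have "(\<lambda>n. T n x) \<longlonglongrightarrow> ennreal (LINT y|\<mu>. bump \<sigma> (x - y))"
      using walk_small_step_limit[OF J_meas J_nonneg J_even J_int pos(1) \<mu> cos_\<mu> sin_\<mu> \<gamma>(1,2)]
      unfolding \<gamma>(3) T_def by (simp add: bump_nonneg)
    moreover have "(\<integral>\<^sup>+y. ennreal (bump \<sigma> (x - y)) \<partial>\<mu>) = ennreal (LINT y|\<mu>. bump \<sigma> (x - y))"
      by (intro nn_integral_eq_integral M.integrable_const_bound[of _ 1]) (auto simp: bump_nonneg bump_le_1)
    ultimately show ?thesis
      by simp
  qed
  have "\<forall>\<^sub>F n in sequentially. t * ((LINT y|lborel. J y * min ((norm y)\<^sup>2) 1) + 1) \<le> real n * min (R\<^sup>2) 1"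
  proof -
    have "0 < min (R\<^sup>2) 1"
      using pos by simp
    moreover obtain k :: nat where
      "t * ((LINT y|lborel. J y * min ((norm y)\<^sup>2) 1) + 1) / min (R\<^sup>2) 1 \<le> real k"
      using real_arch_simple by blast
    ultimately have k: "t * ((LINT y|lborel. J y * min ((norm y)\<^sup>2) 1) + 1) \<le> real k * min (R\<^sup>2) 1"
      by (simp only: pos_divide_le_eq)
    show ?thesis
      using eventually_ge_at_top[of k]
      by eventually_elim (rule order_trans[OF k], intro mult_right_mono, auto)
  qed
  then have T_le: "\<forall>\<^sub>F n in sequentially. (\<integral>\<^sup>+x. indicator U x * T n x \<partial>lborel) \<le> (M * emeasure lborel U + \<eta>) * I"
  proof eventually_elim
    case (elim n)
    obtain g where [measurable]: "g \<in> borel_measurable borel"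
      and g: "\<And>x. T n x \<le> g x + M * I" and g_int: "(\<integral>\<^sup>+x. g x \<partial>lborel) \<le> \<eta> * I"
      using walk_small_step_bound[OF J_meas J_nonneg J_even J_int pos J_lower t_large elim,
          of "\<lambda>x. ennreal (bump \<sigma> x)"]
      unfolding T_def M_def \<eta>_def I_def V_def c1_def S_def by auto
    \<comment> \<open>The flat part is integrated over U only and yields the volume term;
      \<open>g\<close> is integrated over the whole space, where its mass is known.\<close>
    have "(\<integral>\<^sup>+x. indicator U x * T n x \<partial>lborel) \<le> (\<integral>\<^sup>+x. g x + M * I * indicator U x \<partial>lborel)"
      using g by (intro nn_integral_mono) (auto simp: indicator_def add_increasing2)
    also have "\<dots> = (\<integral>\<^sup>+x. g x \<partial>lborel) + M * I * emeasure lborel U"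
      by (simp add: nn_integral_add nn_integral_cmult_indicator)
    also have "\<dots> \<le> \<eta> * I + M * I * emeasure lborel U"
      by (intro add_right_mono g_int)
    also have "\<dots> = (M * emeasure lborel U + \<eta>) * I"
      by (simp add: distrib_left distrib_right mult_ac add.commute)
    finally show ?case .
  qed
  have "(\<integral>\<^sup>+x. indicator U x * (\<integral>\<^sup>+y. ennreal (bump \<sigma> (x - y)) \<partial>\<mu>) \<partial>lborel)
      = (\<integral>\<^sup>+x. liminf (\<lambda>n. indicator U x * T n x) \<partial>lborel)"
  proof (rule nn_integral_cong)
    fix x
    have "(\<lambda>n. indicator U x * T n x) \<longlonglongrightarrow> indicator U x * (\<integral>\<^sup>+y. ennreal (bump \<sigma> (x - y)) \<partial>\<mu>)"
      using T_lim[of x] by (cases "x \<in> U") auto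
    then show "indicator U x * (\<integral>\<^sup>+y. ennreal (bump \<sigma> (x - y)) \<partial>\<mu>) = liminf (\<lambda>n. indicator U x * T n x)"
      by (simp add: lim_imp_Liminf)
  qed
  also have "\<dots> \<le> liminf (\<lambda>n. \<integral>\<^sup>+x. indicator U x * T n x \<partial>lborel)"
    by (rule nn_integral_liminf) measurable
  also have "\<dots> \<le> (M * emeasure lborel U + \<eta>) * I"
    using T_le by (intro Liminf_le) auto
  finally show "(\<integral>\<^sup>+x. indicator U x * (\<integral>\<^sup>+y. ennreal (bump \<sigma> (x - y)) \<partial>\<mu>) \<partial>lborel)
      \<le> (ennreal (S / V * t powr (- (real DIM('a) / \<alpha>))) * emeasure lborel U
        + ennreal (exp (- (c1 * (2 * R) powr (- \<alpha>)) * t))) * (\<integral>\<^sup>+x. ennreal (bump \<sigma> (x :: 'a)) \<partial>lborel)"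
    by (simp add: M_def \<eta>_def I_def)
qed simp

section \<open>Convolution estimates\<close>

text \<open>Young's inequality at the mean c plays the part of the tangent line, and integrating it
  gives the claim. Integrability is not assumed: the integral of a non-integrable function is 0 and
  \<open>0 powr q = 0\<close>, so that case is trivial.\<close>

lemma (in prob_space) jensen_powr:
  fixes g :: "'a \<Rightarrow> real"
  assumes [measurable]: "g \<in> borel_measurable M" and g0: "\<And>x. 0 \<le> g x" and q: "1 \<le> q"
  shows "ennreal ((LINT x|M. g x) powr q) \<le> (\<integral>\<^sup>+x. ennreal (g x powr q) \<partial>M)"
proof -
  define c where "c = (LINT x|M. g x)"
  have c0: "0 \<le> c"
    using g0 by (simp add: c_def integral_nonneg_AE)
  show ?thesis
  proof (cases "integrable M g \<and> c \<noteq> 0 \<and> (\<integral>\<^sup>+x. ennreal (g x powr q) \<partial>M) < top")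
    case False
    then consider "\<not> integrable M g" | "c = 0" | "(\<integral>\<^sup>+x. ennreal (g x powr q) \<partial>M) = top"
      by (auto simp: not_less top_unique)
    then show ?thesis
      by cases (simp_all add: not_integrable_integral_eq c_def)
  next
    case True
    then have c: "0 < c" and int_g: "integrable M g"
      using c0 by auto
    have int_q: "integrable M (\<lambda>x. g x powr q)"
      using True by (intro integrableI_nonneg) auto
    have tangent: "g x * c powr (q - 1) \<le> g x powr q / q + (1 - 1 / q) * c powr q" for x
    proof (cases "g x = 0")
      case True
      then show ?thesis
        using q by simp
    next
      case False
      then have "0 < g x"
        using g0[of x] by simp
      then show ?thesis
        using Youngs_inequality_0[of "1 / q" "1 - 1 / q" "g x powr q" "c powr q"] q c
        by (simp add: powr_powr right_diff_distrib)
    qed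
    have "c powr q = c * c powr (q - 1)"
      using c by (simp add: powr_diff)
    also have "\<dots> = (LINT x|M. g x * c powr (q - 1))"
      by (simp add: c_def)
    also have "\<dots> \<le> (LINT x|M. g x powr q / q + (1 - 1 / q) * c powr q)"
      using int_g int_q tangent by (intro integral_mono) auto
    also have "\<dots> = (LINT x|M. g x powr q) / q + (1 - 1 / q) * c powr q"
      using int_q by (simp add: prob_space)
    finally have "c powr q \<le> (LINT x|M. g x powr q)"
      using q by (simp add: field_simps)
    also have "ennreal (LINT x|M. g x powr q) = (\<integral>\<^sup>+x. ennreal (g x powr q) \<partial>M)"
      using int_q by (intro nn_integral_eq_integral[symmetric]) auto
    finally show ?thesis
      by (simp add: c_def ennreal_leI)
  qed
qed

text \<open>
  The Hahn decomposition is taken against \<open>2 M\<close> instead of \<open>M\<close>: on the complement of \<open>Z\<close> this gives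
  \<open>2 M |X| \<le> \<mu> X \<le> M |X| + \<eta>\<close>, hence \<open>\<mu> X \<le> 2 \<eta>\<close>.  The third \<open>\<eta>\<close> is the mass outside a large ball,
  to which one restricts because the Hahn decomposition needs finite measures.
\<close>

lemma dominated_part:
  fixes \<mu> :: "'a::euclidean_space measure"
  assumes \<mu>: "prob_space \<mu>" "sets \<mu> = sets borel" and pos: "0 < M" "0 < \<eta>"
    and bound: "\<And>E. E \<in> sets borel \<Longrightarrow> emeasure \<mu> E \<le> ennreal M * emeasure lborel E + ennreal \<eta>"
  obtains Z where "Z \<in> sets borel"
    "\<And>f. f \<in> borel_measurable borel \<Longrightarrow>
      (\<integral>\<^sup>+y. indicator Z y * f y \<partial>\<mu>) \<le> ennreal (2 * M) * (\<integral>\<^sup>+y. f y \<partial>lborel)"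
    "emeasure \<mu> (- Z) \<le> ennreal (3 * \<eta>)"
proof -
  interpret prob_space \<mu> by fact
  note [measurable_cong, simp] = \<mu>(2)
  have space: "space \<mu> = UNIV"
    using sets_eq_imp_space_eq[OF \<mu>(2)] by simp
  have "(\<lambda>n. prob (ball 0 (real n))) \<longlonglongrightarrow> prob (\<Union>n. ball 0 (real n))"
    by (rule finite_Lim_measure_incseq) (auto simp: incseq_def)
  moreover have "(\<Union>n. ball 0 (real n)) = (UNIV :: 'a set)"
    by (auto simp: reals_Archimedean2)
  ultimately have "(\<lambda>n. prob (ball 0 (real n))) \<longlonglongrightarrow> 1"
    using prob_space by (simp add: space)
  then have "\<forall>\<^sub>F n in sequentially. 1 - \<eta> < prob (ball 0 (real n))"
    using pos by (intro order_tendstoD) auto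
  then obtain n where n: "1 - \<eta> < prob (ball 0 (real n))"
    by (auto dest: eventually_happens)
  define A :: "'a set" where "A = ball 0 (real n)"
  define L :: "'a measure" where "L = density lborel (\<lambda>_. ennreal (2 * M))"
  have [measurable]: "A \<in> sets borel"
    by (simp add: A_def)
  have L: "emeasure L X = ennreal (2 * M) * emeasure lborel X" if "X \<in> sets borel" for X
    using that by (simp add: L_def emeasure_density nn_integral_cmult_indicator)
  have A_finite: "emeasure lborel A < top"
    by (simp add: A_def emeasure_ball)
  have "\<exists>Y\<in>sets L. Y \<subseteq> A \<and> (\<forall>X\<in>sets L. X \<subseteq> Y \<longrightarrow> \<mu> X \<le> L X) \<and>
      (\<forall>X\<in>sets L. X \<subseteq> A \<longrightarrow> X \<inter> Y = {} \<longrightarrow> L X \<le> \<mu> X)"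
    using A_finite by (intro unsigned_Hahn_decomposition) (auto simp: L_def emeasure_density nn_integral_cmult_indicator ennreal_mult_eq_top_iff)
  then obtain Y where Y [measurable]: "Y \<in> sets borel" and YA: "Y \<subseteq> A"
    and le: "\<And>X. X \<in> sets borel \<Longrightarrow> X \<subseteq> Y \<Longrightarrow> emeasure \<mu> X \<le> emeasure L X"
    and ge: "\<And>X. X \<in> sets borel \<Longrightarrow> X \<subseteq> A \<Longrightarrow> X \<inter> Y = {} \<Longrightarrow> emeasure L X \<le> emeasure \<mu> X"
    by (auto simp: L_def)
  show thesis
  proof
    show "Y \<in> sets borel" by fact
    fix f :: "'a \<Rightarrow> ennreal"
    assume [measurable]: "f \<in> borel_measurable borel"
    have "(\<integral>\<^sup>+y. indicator Y y * f y \<partial>\<mu>) = (\<integral>\<^sup>+y. f y \<partial>density \<mu> (indicator Y))"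
      by (subst nn_integral_density) auto
    also have "\<dots> \<le> (\<integral>\<^sup>+y. f y \<partial>L)"
    proof (rule nn_integral_mono_measure)
      show "density \<mu> (indicator Y) \<le> L"
        unfolding le_measure_iff
      proof (simp add: L_def space, intro le_funI)
        fix X
        show "emeasure (density \<mu> (indicator Y)) X \<le> emeasure (density lborel (\<lambda>_. ennreal (2 * M))) X"
        proof (cases "X \<in> sets borel")
          case X [measurable]: True
          have "emeasure (density \<mu> (indicator Y)) X = emeasure \<mu> (Y \<inter> X)"
            by (simp add: emeasure_density indicator_inter_arith[symmetric])
          also have "\<dots> \<le> emeasure L (Y \<inter> X)"
            by (rule le) auto
          also have "\<dots> \<le> emeasure L X"
            by (rule emeasure_mono) (auto simp: L_def)
          finally show ?thesis by (simp add: L_def)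
        qed (simp add: emeasure_notin_sets)
      qed
    qed (simp add: L_def)
    also have "\<dots> = ennreal (2 * M) * (\<integral>\<^sup>+y. f y \<partial>lborel)"
      by (simp add: L_def nn_integral_density nn_integral_cmult)
    finally show "(\<integral>\<^sup>+y. indicator Y y * f y \<partial>\<mu>) \<le> ennreal (2 * M) * (\<integral>\<^sup>+y. f y \<partial>lborel)" .
  next
    let ?X = "A - Y"
    have X [measurable]: "?X \<in> sets borel"
      by measurable
    \<comment> \<open>Finite volume makes it legitimate to subtract \<open>M * l\<close> from both
      bounds below.\<close>
    have X_finite: "emeasure lborel ?X < top"
      using A_finite emeasure_mono[of ?X A lborel] by (auto intro: le_less_trans)
    define l where "l = measure lborel ?X"
    have l: "emeasure lborel ?X = ennreal l" "0 \<le> l"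
      using X_finite by (simp_all add: l_def emeasure_eq_ennreal_measure less_top)
    have "ennreal (2 * M) * ennreal l \<le> ennreal (prob ?X)"
      using ge[OF X] L[OF X] l by (auto simp: emeasure_eq_measure)
    then have "2 * M * l \<le> prob ?X"
      using pos l by (simp add: ennreal_mult[symmetric] ennreal_le_iff)
    moreover have "ennreal (prob ?X) \<le> ennreal (M * l + \<eta>)"
      using bound[OF X] pos l by (simp add: emeasure_eq_measure ennreal_mult[symmetric] ennreal_plus[symmetric] del: ennreal_plus)
    then have "prob ?X \<le> M * l + \<eta>"
      using pos l by (subst (asm) ennreal_le_iff) auto
    ultimately have 1: "prob ?X \<le> 2 * \<eta>"
      by linarith
    have 2: "prob (- A) \<le> \<eta>"
      using prob_compl[of A] n by (simp add: space Compl_eq_Diff_UNIV A_def)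
    have "- Y = ?X \<union> - A"
      using YA by auto
    then have "prob (- Y) = prob ?X + prob (- A)"
      by (simp only:) (rule finite_measure_Union, auto)
    with 1 2 have "prob (- Y) \<le> 3 * \<eta>"
      by linarith
    then show "emeasure \<mu> (- Y) \<le> ennreal (3 * \<eta>)"
      by (simp add: emeasure_eq_measure ennreal_leI)
  qed
qed

lemma powr_add_le:
  fixes a b p :: real
  assumes "0 \<le> a" "0 \<le> b" "0 \<le> p"
  shows "(a + b) powr p \<le> 2 powr p * (a powr p + b powr p)"
proof -
  have "(a + b) powr p \<le> (2 * max a b) powr p"
    using assms by (intro powr_mono2) auto
  also have "\<dots> = 2 powr p * max a b powr p"
    using assms by (simp add: powr_mult)
  also have "max a b powr p \<le> a powr p + b powr p"
    by (simp add: max_def)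
  finally show ?thesis
    by simp
qed

text \<open>The part of \<open>\<mu>\<close> on Z has density at most 2 M. It maps L^q to bounded
  functions and L^q to L^q, and interpolating the two gives the p-th power. The rest has mass at
  most 3 \<eta> and is estimated in L^p alone. Jensen is applied under the full \<open>\<mu>\<close>
  to \<open>f\<close> cut off by an indicator, so neither part has to be renormalised.\<close>

lemma conv_measure_powr_bound:
  fixes \<mu> :: "'a::euclidean_space measure" and f :: "'a \<Rightarrow> real"
  assumes \<mu>: "prob_space \<mu>" "sets \<mu> = sets borel" and pos: "0 < M" "0 < \<eta>"
    and bound: "\<And>E. E \<in> sets borel \<Longrightarrow> emeasure \<mu> E \<le> ennreal M * emeasure lborel E + ennreal \<eta>"
    and [measurable]: "f \<in> borel_measurable borel"
    and q: "1 \<le> q" "q < p"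
    and int_q: "integrable lborel (\<lambda>x. \<bar>f x\<bar> powr q)" and int_p: "integrable lborel (\<lambda>x. \<bar>f x\<bar> powr p)"
  shows "(\<integral>\<^sup>+x. ennreal (\<bar>conv_measure f \<mu> x\<bar> powr p) \<partial>lborel)
    \<le> ennreal (2 powr p * ((2 * M) powr (p / q - 1) * (LINT x|lborel. \<bar>f x\<bar> powr q) powr (p / q)
        + 3 * \<eta> * (LINT x|lborel. \<bar>f x\<bar> powr p)))"
proof -
  interpret prob_space \<mu> by fact
  note [measurable_cong] = \<mu>(2)
  interpret P: pair_sigma_finite lborel \<mu> ..
  obtain Z where Z [measurable]: "Z \<in> sets borel"
    and Z1: "\<And>f. f \<in> borel_measurable borel \<Longrightarrow>
      (\<integral>\<^sup>+y. indicator Z y * f y \<partial>\<mu>) \<le> ennreal (2 * M) * (\<integral>\<^sup>+y. f y \<partial>lborel)"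
    and Z2: "emeasure \<mu> (- Z) \<le> ennreal (3 * \<eta>)"
    using dominated_part[OF \<mu> pos bound] by blast
  define Fq where "Fq = (LINT x|lborel. \<bar>f x\<bar> powr q)"
  define Fp where "Fp = (LINT x|lborel. \<bar>f x\<bar> powr p)"
  have F0: "0 \<le> Fq" "0 \<le> Fp"
    by (simp_all add: Fq_def Fp_def integral_nonneg_AE)
  have Fq: "(\<integral>\<^sup>+x. ennreal (\<bar>f x\<bar> powr q) \<partial>lborel) = ennreal Fq"
    unfolding Fq_def using int_q by (intro nn_integral_eq_integral) auto
  have Fp: "(\<integral>\<^sup>+x. ennreal (\<bar>f x\<bar> powr p) \<partial>lborel) = ennreal Fp"
    unfolding Fp_def using int_p by (intro nn_integral_eq_integral) auto
  define a where "a x = (LINT y|\<mu>. indicator Z y * \<bar>f (x - y)\<bar>)" for x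
  define b where "b x = (LINT y|\<mu>. indicator (- Z) y * \<bar>f (x - y)\<bar>)" for x
  have [measurable]: "a \<in> borel_measurable borel" "b \<in> borel_measurable borel"
    unfolding a_def b_def by measurable
  have ab0: "0 \<le> a x" "0 \<le> b x" for x
    by (simp_all add: a_def b_def integral_nonneg_AE)
  have conv_le: "\<bar>conv_measure f \<mu> x\<bar> \<le> a x + b x" for x
  \<comment> \<open>Where the convolution does not converge, \<open>conv_measure\<close> is 0 by
    default and the bound is trivial.\<close>
  proof (cases "integrable \<mu> (\<lambda>y. f (x - y))")
    case True
    have "\<bar>conv_measure f \<mu> x\<bar> \<le> (LINT y|\<mu>. \<bar>f (x - y)\<bar>)"
      unfolding conv_measure_def using integral_norm_bound[of \<mu> "\<lambda>y. f (x - y)"] by simp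
    also have "\<dots> = (LINT y|\<mu>. indicator Z y * \<bar>f (x - y)\<bar> + indicator (- Z) y * \<bar>f (x - y)\<bar>)"
      by (intro Bochner_Integration.integral_cong) (auto simp: indicator_def)
    also have "\<dots> = a x + b x"
      unfolding a_def b_def
      by (intro Bochner_Integration.integral_add Bochner_Integration.integrable_bound[OF True])
        (auto simp: indicator_def)
    finally show ?thesis .
  next
    case False
    then show ?thesis
      using ab0[of x] by (simp add: conv_measure_def not_integrable_integral_eq)
  qed
  have a_q: "ennreal (a x powr q) \<le> (\<integral>\<^sup>+y. indicator Z y * ennreal (\<bar>f (x - y)\<bar> powr q) \<partial>\<mu>)" for x
    unfolding a_def using jensen_powr[of "\<lambda>y. indicator Z y * \<bar>f (x - y)\<bar>" q] q
    by (auto elim!: order_trans intro!: nn_integral_mono simp: indicator_def)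
  have b_p: "ennreal (b x powr p) \<le> (\<integral>\<^sup>+y. indicator (- Z) y * ennreal (\<bar>f (x - y)\<bar> powr p) \<partial>\<mu>)" for x
    unfolding b_def using jensen_powr[of "\<lambda>y. indicator (- Z) y * \<bar>f (x - y)\<bar>" p] q
    by (auto elim!: order_trans intro!: nn_integral_mono simp: indicator_def)
  have shift: "(\<integral>\<^sup>+x. g (x - y) \<partial>lborel) = (\<integral>\<^sup>+x. g x \<partial>lborel)"
    if [measurable]: "g \<in> borel_measurable borel" for g :: "'a \<Rightarrow> ennreal" and y
    using nn_integral_lborel_shift[of g "- y"] by simp
  have refl: "(\<integral>\<^sup>+y. g (x - y) \<partial>lborel) = (\<integral>\<^sup>+y. g y \<partial>lborel)"
    if [measurable]: "g \<in> borel_measurable borel" for g :: "'a \<Rightarrow> ennreal" and x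
  proof -
    have "(\<integral>\<^sup>+y. g (x - y) \<partial>lborel) = (\<integral>\<^sup>+y. g (y + x) \<partial>distr lborel borel uminus)"
      by (subst nn_integral_distr) auto
    then show ?thesis
      by (simp add: lborel_distr_uminus_euclidean nn_integral_lborel_shift)
  qed
  define s where "s = (2 * M * Fq) powr (1 / q)"
  have a_le: "a x \<le> s" for x
  proof -
    have "ennreal (a x powr q) \<le> ennreal (2 * M) * (\<integral>\<^sup>+y. ennreal (\<bar>f (x - y)\<bar> powr q) \<partial>lborel)"
      using a_q[of x] Z1[of "\<lambda>y. ennreal (\<bar>f (x - y)\<bar> powr q)"] by (auto intro: order_trans)
    also have "\<dots> = ennreal (2 * M * Fq)"
      using refl[of "\<lambda>y. ennreal (\<bar>f y\<bar> powr q)" x] Fq pos F0 by (simp add: ennreal_mult[symmetric])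
    finally have "a x powr q \<le> 2 * M * Fq"
      using pos F0 by (simp add: ennreal_le_iff)
    then have "(a x powr q) powr (1 / q) \<le> s"
      unfolding s_def using q by (intro powr_mono2) auto
    then show ?thesis
      using q ab0[of x] by (simp add: powr_powr)
  qed
  have total: "(\<integral>\<^sup>+x. (\<integral>\<^sup>+y. indicator B y * ennreal (\<bar>f (x - y)\<bar> powr r) \<partial>\<mu>) \<partial>lborel)
      = emeasure \<mu> B * (\<integral>\<^sup>+x. ennreal (\<bar>f x\<bar> powr r) \<partial>lborel)"
    if [measurable]: "B \<in> sets borel" for B r
  proof -
    have "(\<integral>\<^sup>+x. (\<integral>\<^sup>+y. indicator B y * ennreal (\<bar>f (x - y)\<bar> powr r) \<partial>\<mu>) \<partial>lborel)
        = (\<integral>\<^sup>+y. (\<integral>\<^sup>+x. indicator B y * ennreal (\<bar>f (x - y)\<bar> powr r) \<partial>lborel) \<partial>\<mu>)"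
      by (rule P.Fubini'[symmetric]) measurable
    also have "\<dots> = (\<integral>\<^sup>+y. (\<integral>\<^sup>+x. ennreal (\<bar>f x\<bar> powr r) \<partial>lborel) * indicator B y \<partial>\<mu>)"
      using shift[of "\<lambda>x. ennreal (\<bar>f x\<bar> powr r)"]
      by (intro nn_integral_cong) (simp add: nn_integral_cmult mult.commute)
    also have "\<dots> = (\<integral>\<^sup>+x. ennreal (\<bar>f x\<bar> powr r) \<partial>lborel) * emeasure \<mu> B"
      by (rule nn_integral_cmult_indicator) (simp add: \<mu>)
    finally show ?thesis
      by (simp add: mult.commute)
  qed
  have a_int: "(\<integral>\<^sup>+x. ennreal (a x powr q) \<partial>lborel) \<le> ennreal Fq"
  proof -
    have "(\<integral>\<^sup>+x. ennreal (a x powr q) \<partial>lborel)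
        \<le> (\<integral>\<^sup>+x. (\<integral>\<^sup>+y. indicator Z y * ennreal (\<bar>f (x - y)\<bar> powr q) \<partial>\<mu>) \<partial>lborel)"
      using a_q by (intro nn_integral_mono)
    also have "\<dots> = emeasure \<mu> Z * ennreal Fq"
      by (simp add: total Fq)
    also have "\<dots> \<le> 1 * ennreal Fq"
      by (intro mult_right_mono emeasure_le_1) auto
    finally show ?thesis by simp
  qed
  have a_p: "(\<integral>\<^sup>+x. ennreal (a x powr p) \<partial>lborel) \<le> ennreal ((2 * M) powr (p / q - 1) * Fq powr (p / q))"
  proof -
    \<comment> \<open>The interpolation: p - q of the powers are spent on the sup bound
      \<open>s\<close>, the other q on the integral bound \<open>a_int\<close>.\<close>
    have "a x powr p \<le> s powr (p - q) * a x powr q" for x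
    proof -
      have "a x powr p = a x powr (p - q) * a x powr q"
        by (simp add: powr_add[symmetric])
      also have "\<dots> \<le> s powr (p - q) * a x powr q"
        using a_le ab0 q by (intro mult_right_mono powr_mono2) auto
      finally show ?thesis .
    qed
    then have "(\<integral>\<^sup>+x. ennreal (a x powr p) \<partial>lborel) \<le> (\<integral>\<^sup>+x. ennreal (s powr (p - q)) * ennreal (a x powr q) \<partial>lborel)"
      by (intro nn_integral_mono) (simp add: ennreal_mult[symmetric] ennreal_leI)
    also have "\<dots> = ennreal (s powr (p - q)) * (\<integral>\<^sup>+x. ennreal (a x powr q) \<partial>lborel)"
      by (simp add: nn_integral_cmult)
    also have "\<dots> \<le> ennreal (s powr (p - q)) * ennreal Fq"
      by (intro mult_left_mono a_int) simp
    also have "\<dots> = ennreal (s powr (p - q) * Fq)"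
      using F0 by (simp add: ennreal_mult)
    also have "s powr (p - q) * Fq = (2 * M) powr (p / q - 1) * Fq powr (p / q)"
    proof -
      have e: "(p - q) / q = p / q - 1"
        using q by (simp add: diff_divide_distrib)
      have "s powr (p - q) = (2 * M * Fq) powr (p / q - 1)"
        by (simp add: s_def powr_powr e)
      also have "\<dots> = (2 * M) powr (p / q - 1) * Fq powr (p / q - 1)"
        using pos F0 by (simp add: powr_mult)
      finally have "s powr (p - q) * Fq = (2 * M) powr (p / q - 1) * (Fq powr (p / q - 1) * Fq powr 1)"
        using F0 by simp
      also have "Fq powr (p / q - 1) * Fq powr 1 = Fq powr (p / q)"
        by (simp only: powr_add[symmetric]) simp
      finally show ?thesis .
    qed
    finally show ?thesis .
  qed
  have b_p': "(\<integral>\<^sup>+x. ennreal (b x powr p) \<partial>lborel) \<le> ennreal (3 * \<eta> * Fp)"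
  proof -
    have "(\<integral>\<^sup>+x. ennreal (b x powr p) \<partial>lborel)
        \<le> (\<integral>\<^sup>+x. (\<integral>\<^sup>+y. indicator (- Z) y * ennreal (\<bar>f (x - y)\<bar> powr p) \<partial>\<mu>) \<partial>lborel)"
      using b_p by (intro nn_integral_mono)
    also have "\<dots> = emeasure \<mu> (- Z) * ennreal Fp"
      by (simp add: total Fp)
    also have "\<dots> \<le> ennreal (3 * \<eta>) * ennreal Fp"
      by (intro mult_right_mono Z2) auto
    finally show ?thesis
      using pos F0 by (simp add: ennreal_mult[symmetric])
  qed
  have "\<bar>conv_measure f \<mu> x\<bar> powr p \<le> 2 powr p * (a x powr p + b x powr p)" for x
  proof -
    have "\<bar>conv_measure f \<mu> x\<bar> powr p \<le> (a x + b x) powr p"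
      using conv_le q by (intro powr_mono2) auto
    also have "\<dots> \<le> 2 powr p * (a x powr p + b x powr p)"
      using ab0 q by (intro powr_add_le) auto
    finally show ?thesis .
  qed
  then have "(\<integral>\<^sup>+x. ennreal (\<bar>conv_measure f \<mu> x\<bar> powr p) \<partial>lborel)
      \<le> (\<integral>\<^sup>+x. ennreal (2 powr p) * (ennreal (a x powr p) + ennreal (b x powr p)) \<partial>lborel)"
    by (intro nn_integral_mono) (simp add: ennreal_mult[symmetric] ennreal_plus[symmetric] ennreal_leI del: ennreal_plus)
  also have "\<dots> = ennreal (2 powr p) * ((\<integral>\<^sup>+x. ennreal (a x powr p) \<partial>lborel) + (\<integral>\<^sup>+x. ennreal (b x powr p) \<partial>lborel))"
    by (simp add: nn_integral_cmult nn_integral_add)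
  also have "\<dots> \<le> ennreal (2 powr p) * (ennreal ((2 * M) powr (p / q - 1) * Fq powr (p / q)) + ennreal (3 * \<eta> * Fp))"
    by (intro mult_left_mono add_mono a_p b_p') simp
  also have "\<dots> = ennreal (2 powr p * ((2 * M) powr (p / q - 1) * Fq powr (p / q) + 3 * \<eta> * Fp))"
    using pos F0 by (simp add: ennreal_mult[symmetric] ennreal_plus[symmetric] del: ennreal_plus)
  finally show ?thesis
    by (simp add: Fq_def Fp_def)
qed

section \<open>Decay of solutions\<close>

lemma AE_lborel_uminus:
  assumes "AE z in (lborel :: 'a::euclidean_space measure). P z"
  shows "AE z in (lborel :: 'a measure). P (- z)"
proof -
  obtain N where "{z \<in> space lborel. \<not> P z} \<subseteq> N" "emeasure lborel N = 0" "N \<in> sets lborel"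
    using assms by (rule AE_E)
  then have N: "N \<in> null_sets lborel" "{z. \<not> P z} \<subseteq> N"
    by auto
  have "AE z in distr lborel borel uminus. z \<notin> N"
    using N(1) by (subst lborel_distr_uminus_euclidean) (rule AE_not_in)
  then have "AE z in lborel. - z \<notin> N"
    using N(1) by (subst (asm) AE_distr_iff) (auto simp: null_sets_def)
  then show ?thesis
    using N(2) by (auto elim!: eventually_mono)
qed

text \<open>The walk lemmas need Borel measurability, nonnegativity, evenness and the lower bound at
  every point, whereas a Borel version of \<open>J\<close> has the last three only almost
  everywhere. Taking the maximum with the lower bound and then with the reflection restores them and
  changes nothing off a null set, because \<open>J\<close> itself satisfies them away from
  0.\<close>

lemma jump_kernel_borel_version:
  fixes J :: "'a::euclidean_space \<Rightarrow> real"
  assumes J: "jump_kernel J" and "0 < c0"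
    and lower: "\<And>z. R \<le> norm z \<Longrightarrow> c0 * norm z powr \<beta> \<le> J z"
  obtains J' :: "'a \<Rightarrow> real" where
    "J' \<in> borel_measurable borel" "\<And>z. 0 \<le> J' z" "\<And>z. J' (- z) = J' z"
    "integrable lborel (\<lambda>z. J' z * min ((norm z)\<^sup>2) 1)"
    "\<And>z. R \<le> norm z \<Longrightarrow> c0 * norm z powr \<beta> \<le> J' z"
    "\<And>\<xi>. multiplier J \<xi> = (LINT z|lborel. (1 - cos (z \<bullet> \<xi>)) * J' z)"
proof -
  have J_meas: "J \<in> borel_measurable lebesgue"
    and J_nonneg: "\<And>z. z \<noteq> 0 \<Longrightarrow> 0 \<le> J z"
    and J_radial: "\<And>y z. y \<noteq> 0 \<Longrightarrow> z \<noteq> 0 \<Longrightarrow> norm y = norm z \<Longrightarrow> J y = J z"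
    and J_int: "integrable lebesgue (\<lambda>z. J z * min ((norm z)\<^sup>2) 1)"
    using J unfolding jump_kernel_def by blast+
  obtain J0 where J0 [measurable]: "J0 \<in> borel_measurable borel" and J0_eq: "AE z in lborel. J z = J0 z"
    using completion_ex_borel_measurable_real[OF J_meas] by auto
  define L where "L z = (if R \<le> norm z then c0 * norm z powr \<beta> else 0)" for z :: 'a
  define J1 where "J1 z = max (L z) (J0 z)" for z
  define J' where "J' z = max (J1 z) (J1 (- z))" for z
  have [measurable]: "L \<in> borel_measurable borel"
    unfolding L_def by measurable
  have [measurable]: "J1 \<in> borel_measurable borel"
    unfolding J1_def by measurable
  have J'_meas [measurable]: "J' \<in> borel_measurable borel"
    unfolding J'_def by measurable
  have L0: "0 \<le> L z" for z
    using \<open>0 < c0\<close> by (simp add: L_def)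
  have J'_eq: "AE z in lborel. J' z = J z"
    \<comment> \<open>Agreement is needed at z and -z simultaneously, and the origin is discarded
      because the radial symmetry does not cover it.\<close>
    using J0_eq AE_lborel_uminus[OF J0_eq] AE_lborel_singleton[of 0]
  proof eventually_elim
    case (elim z)
    have "J (- z) = J z"
      using elim by (intro J_radial) auto
    moreover have L: "L z \<le> J z" "L (- z) = L z"
      using elim lower[of z] J_nonneg[of z] by (auto simp: L_def)
    ultimately have "J1 (- z) = J z" "J1 z = J z"
      unfolding J1_def elim(1,2)[symmetric] by simp_all
    then show ?case
      by (simp add: J'_def)
  qed
  have J'_eq': "AE z in lebesgue. J' z = J z"
    using J'_eq by (simp add: AE_completion_iff)
  show thesis
  proof
    show "J' \<in> borel_measurable borel" by fact
    show "0 \<le> J' z" for z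
      using L0[of z] by (simp add: J'_def J1_def le_max_iff_disj)
    show "J' (- z) = J' z" for z
      by (simp add: J'_def max.commute)
    show "c0 * norm z powr \<beta> \<le> J' z" if "R \<le> norm z" for z
      using that by (simp add: J'_def J1_def L_def le_max_iff_disj)
    have "integrable lebesgue (\<lambda>z. J' z * min ((norm z)\<^sup>2) 1)"
    proof (rule integrable_cong_AE_imp[OF J_int])
      show "(\<lambda>z. J' z * min ((norm z)\<^sup>2) 1) \<in> borel_measurable lebesgue"
        by (rule measurable_completion) measurable
      show "AE z in lebesgue. J z * min ((norm z)\<^sup>2) 1 = J' z * min ((norm z)\<^sup>2) 1"
        using J'_eq' by eventually_elim simp
    qed
    then show "integrable lborel (\<lambda>z. J' z * min ((norm z)\<^sup>2) 1)"
      by (subst (asm) integrable_completion) measurable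
    show "multiplier J \<xi> = (LINT z|lborel. (1 - cos (z \<bullet> \<xi>)) * J' z)" for \<xi>
    proof -
      have m1: "(\<lambda>z. (1 - cos (z \<bullet> \<xi>)) * J' z) \<in> borel_measurable lebesgue"
        by (rule measurable_completion) measurable
      have m2: "(\<lambda>z. (1 - cos (z \<bullet> \<xi>))) \<in> borel_measurable lebesgue"
        by (rule measurable_completion) measurable
      have "multiplier J \<xi> = (LINT z|lebesgue. (1 - cos (z \<bullet> \<xi>)) * J' z)"
        unfolding multiplier_def
        by (rule integral_cong_AE[OF borel_measurable_times[OF m2 J_meas] m1])
          (rule eventually_mono[OF J'_eq'], simp)
      also have "\<dots> = (LINT z|lborel. (1 - cos (z \<bullet> \<xi>)) * J' z)"
        by (rule integral_completion) measurable
      finally show ?thesis .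
    qed
  qed
qed

lemma heat_measure_cos_sin:
  fixes \<mu> :: "'a::euclidean_space measure"
  assumes "is_heat_measure J t \<mu>"
  shows "(LINT x|\<mu>. cos (x \<bullet> \<xi>)) = exp (- multiplier J \<xi> * t)"
    and "(LINT x|\<mu>. sin (x \<bullet> \<xi>)) = 0"
proof -
  have \<mu>: "prob_space \<mu>" "sets \<mu> = sets borel"
    and F: "(LINT x|\<mu>. cis (- (x \<bullet> \<xi>))) = complex_of_real (exp (- multiplier J \<xi> * t))"
    using assms by (auto simp: is_heat_measure_def fourier_measure_def)
  interpret prob_space \<mu> by fact
  note [measurable_cong] = \<mu>(2)
  have int: "integrable \<mu> (\<lambda>x. cis (- (x \<bullet> \<xi>)))"
    by (intro integrable_const_bound[of _ 1]) (auto simp: cis_conv_exp)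
  have "(LINT x|\<mu>. Re (cis (- (x \<bullet> \<xi>)))) = exp (- multiplier J \<xi> * t)"
    by (subst integral_Re[OF int]) (simp only: F Re_complex_of_real)
  then show "(LINT x|\<mu>. cos (x \<bullet> \<xi>)) = exp (- multiplier J \<xi> * t)"
    by simp
  have "(LINT x|\<mu>. Im (cis (- (x \<bullet> \<xi>)))) = 0"
    by (subst integral_Im[OF int]) (simp only: F Im_complex_of_real)
  then show "(LINT x|\<mu>. sin (x \<bullet> \<xi>)) = 0"
    by simp
qed

lemma powr_interpolate:
  fixes x :: real
  assumes "0 \<le> x" "a \<le> r" "r \<le> b"
  shows "x powr r \<le> x powr a + x powr b"
proof (cases "x \<le> 1")
  case True
  then have "x powr r \<le> x powr a"
    using assms by (cases "x = 0") (auto intro: powr_mono')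
  then show ?thesis
    by (simp add: add_increasing2)
next
  case False
  then have "x powr r \<le> x powr b"
    using assms by (intro powr_mono) auto
  then show ?thesis
    by (simp add: add_increasing)
qed

lemma exp_decay_beats_powr:
  fixes c \<beta> F k :: real
  assumes "0 < c" "0 < k"
  shows "\<forall>\<^sub>F t in at_top. F * exp (- c * t) \<le> t powr (- \<beta>) * k"
proof -
  have "((\<lambda>t. F * exp (- c * t) * t powr \<beta>) \<longlongrightarrow> 0) at_top"
    using \<open>0 < c\<close> by real_asymp
  then have "\<forall>\<^sub>F t in at_top. F * exp (- c * t) * t powr \<beta> < k"
    using \<open>0 < k\<close> by (intro order_tendstoD) auto
  then show ?thesis
    using eventually_gt_at_top[of 0]
    by eventually_elim (simp add: powr_minus field_simps)
qed

text \<open>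
  Uniformity in \<open>q\<close> is what allows a single \<open>t\<^sub>0\<close> for all exponents; it comes from
  \<open>min |f| (|f| powr p) \<le> |f| powr q\<close>.
\<close>

lemma integral_powr_lower_bound:
  fixes f :: "'a::euclidean_space \<Rightarrow> real"
  assumes f: "f \<in> borel_measurable borel" and p: "1 < p"
    and int: "\<And>q. 1 \<le> q \<Longrightarrow> q \<le> p \<Longrightarrow> integrable lborel (\<lambda>x. \<bar>f x\<bar> powr q)"
    and nz: "(LINT x|lborel. \<bar>f x\<bar> powr p) \<noteq> 0"
  obtains k where "0 < k"
    "\<And>q. 1 \<le> q \<Longrightarrow> q < p \<Longrightarrow> k \<le> (LINT x|lborel. \<bar>f x\<bar> powr q) powr (p / q)"
proof -
  note [measurable] = f
  define m where "m x = min \<bar>f x\<bar> (\<bar>f x\<bar> powr p)" for x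
  have [measurable]: "m \<in> borel_measurable borel"
    unfolding m_def by measurable
  have m0: "0 \<le> m x" for x
    by (simp add: m_def)
  have int_m: "integrable lborel m"
  proof (rule Bochner_Integration.integrable_bound)
    show "integrable lborel (\<lambda>x. \<bar>f x\<bar> powr p)"
      using p by (intro int) auto
  qed (auto simp: m_def)
  \<comment> \<open>Capping at 1 gives \<open>\<kappa> powr p \<le> \<kappa> powr (p / q)\<close>,
    hence a bound free of q.\<close>
  define \<kappa> where "\<kappa> = min 1 (LINT x|lborel. m x)"
  have "(LINT x|lborel. m x) \<noteq> 0"
  proof
    assume "(LINT x|lborel. m x) = 0"
    then have "AE x in lborel. m x = 0"
      using integral_nonneg_eq_0_iff_AE[OF int_m] m0 by simp
    then have "AE x in lborel. \<bar>f x\<bar> powr p = 0"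
      by eventually_elim (auto simp: m_def min_def split: if_splits)
    then have "(LINT x|lborel. \<bar>f x\<bar> powr p) = 0"
      by (rule integral_eq_zero_AE)
    with nz show False ..
  qed
  moreover have "0 \<le> (LINT x|lborel. m x)"
    using m0 by (intro integral_nonneg_AE) auto
  ultimately have \<kappa>: "0 < \<kappa>" "\<kappa> \<le> 1"
    by (auto simp: \<kappa>_def)
  show thesis
  proof
    show "0 < \<kappa> powr p"
      using \<kappa> by simp
    fix q :: real
    assume q: "1 \<le> q" "q < p"
    have "m x \<le> \<bar>f x\<bar> powr q" for x
    proof (cases "\<bar>f x\<bar> \<le> 1")
      case True
      then have "\<bar>f x\<bar> powr p \<le> \<bar>f x\<bar> powr q"
        using q by (cases "f x = 0") (auto intro: powr_mono')
      then show ?thesis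
        by (simp add: m_def min_le_iff_disj)
    next
      case False
      then have "\<bar>f x\<bar> powr 1 \<le> \<bar>f x\<bar> powr q"
        using q by (intro powr_mono) auto
      then show ?thesis
        by (simp add: m_def min_le_iff_disj)
    qed
    then have "(LINT x|lborel. m x) \<le> (LINT x|lborel. \<bar>f x\<bar> powr q)"
      using q by (intro integral_mono int_m int) auto
    then have "\<kappa> \<le> (LINT x|lborel. \<bar>f x\<bar> powr q)"
      by (simp add: \<kappa>_def)
    then have "\<kappa> powr (p / q) \<le> (LINT x|lborel. \<bar>f x\<bar> powr q) powr (p / q)"
      using \<kappa> q by (intro powr_mono2) auto
    moreover have "\<kappa> powr p \<le> \<kappa> powr (p / q)"
      using \<kappa> q by (intro powr_mono') (auto simp: field_simps)
    ultimately show "\<kappa> powr p \<le> (LINT x|lborel. \<bar>f x\<bar> powr q) powr (p / q)"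
      by simp
  qed
qed

theorem theorem4p8:
  fixes J :: "'a::euclidean_space \<Rightarrow> real" and p \<alpha> c0 R :: real
  assumes "jump_kernel J"
    and "1 < p"
    and "0 < \<alpha>" and "\<alpha> \<le> 2"
    and "0 < c0" and "0 < R"
    and "\<forall>z. R \<le> norm z \<longrightarrow> c0 * norm z powr (- real DIM('a) - \<alpha>) \<le> J z"
  shows "\<exists>c :: real \<Rightarrow> real. (\<forall>q. 1 \<le> q \<and> q < p \<longrightarrow> 0 < c q) \<and>
    (\<forall>u0 u. u0 \<in> Lp 1 \<and> u0 \<in> Lp (max p 2) \<and> is_solution J u0 u \<longrightarrow>
      (\<exists>t0>0. \<forall>t>t0. \<forall>q. 1 \<le> q \<and> q < p \<longrightarrow>
        u t \<in> Lp p \<and>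
        Lp_norm p (u t)
          \<le> c q * t powr (- (real DIM('a) / \<alpha>) * (1 / q - 1 / p)) * Lp_norm q u0))"
proof -
  let ?N = "real DIM('a)"
  obtain J' :: "'a \<Rightarrow> real" where J': "J' \<in> borel_measurable borel" "\<And>z. 0 \<le> J' z" "\<And>z. J' (- z) = J' z"
      "integrable lborel (\<lambda>z. J' z * min ((norm z)\<^sup>2) 1)"
      "\<And>z. R \<le> norm z \<Longrightarrow> c0 * norm z powr (- ?N - \<alpha>) \<le> J' z"
      "\<And>\<xi>. multiplier J \<xi> = (LINT z|lborel. (1 - cos (z \<bullet> \<xi>)) * J' z)"
    using jump_kernel_borel_version[OF assms(1,5), of R "- ?N - \<alpha>"] assms(7) by blast
  define V where "V = annulus_vol TYPE('a)"
  define c1 where "c1 = c0 * 2 powr (- ?N - \<alpha>) * V"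
  define S where "S = (\<Sum>i. 2 ^ (i * DIM('a)) * level_weight c1 \<alpha> i)"
  define C where "C = S / V"
  define c2 where "c2 = c1 * (2 * R) powr (- \<alpha>)"
  \<comment> \<open>The power of \<open>2 * C\<close> comes from the bounded-density part and the 1
    pays for the remainder, which is eventually below the main term without its constant. The 2 in
    \<open>c\<close> is the p-th root of the factor from \<open>powr_add_le\<close>.\<close>
  define A where "A q = (2 * C) powr (p / q - 1) + 1" for q
  define c where "c q = 2 * A q powr (1 / p)" for q
  have V: "0 < V"
    by (simp add: V_def annulus_vol_pos)
  have c1: "0 < c1"
    using assms V by (simp add: c1_def)
  have c2: "0 < c2"
    using assms c1 by (simp add: c2_def)
  have "0 < S"
    unfolding S_def using summable_level_weight[OF c1 assms(3), of "DIM('a)"]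
    by (rule suminf_pos) (simp add: level_weight_def)
  then have C: "0 < C"
    using V by (simp add: C_def)
  have A: "0 < A q" for q
    by (simp add: A_def add_nonneg_pos)
  show ?thesis
  proof (intro exI[of _ c] conjI allI impI)
    show "0 < c q" for q
      using A[of q] by (simp add: c_def)
    fix u0 :: "'a \<Rightarrow> real" and u :: "real \<Rightarrow> 'a \<Rightarrow> real"
    assume asm: "u0 \<in> Lp 1 \<and> u0 \<in> Lp (max p 2) \<and> is_solution J u0 u"
    then have u0_meas [measurable]: "u0 \<in> borel_measurable borel"
      and u0_1: "integrable lborel (\<lambda>x. \<bar>u0 x\<bar> powr 1)"
      and u0_p: "integrable lborel (\<lambda>x. \<bar>u0 x\<bar> powr (max p 2))"
      and sol: "is_solution J u0 u"
      by (auto simp: Lp_def)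
    have int: "integrable lborel (\<lambda>x. \<bar>u0 x\<bar> powr q)" if "1 \<le> q" "q \<le> p" for q
    proof (rule Bochner_Integration.integrable_bound[OF Bochner_Integration.integrable_add[OF u0_1 u0_p]])
      show "AE x in lborel. norm (\<bar>u0 x\<bar> powr q) \<le> norm (\<bar>u0 x\<bar> powr 1 + \<bar>u0 x\<bar> powr (max p 2))"
        using that powr_interpolate[of "\<bar>u0 _\<bar>" 1 q "max p 2"] by (intro AE_I2) auto
    qed measurable
    define F where "F q = (LINT x|lborel. \<bar>u0 x\<bar> powr q)" for q
    have F0: "0 \<le> F q" for q
      by (simp add: F_def integral_nonneg_AE)
    define \<beta> where "\<beta> = ?N / \<alpha>"
    have \<beta>: "0 \<le> \<beta>"
      using assms by (simp add: \<beta>_def)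
    have "\<forall>\<^sub>F t in at_top. \<forall>q. 1 \<le> q \<and> q < p \<longrightarrow>
        3 * exp (- c2 * t) * F p \<le> t powr (- \<beta> * (p / q - 1)) * F q powr (p / q)"
    proof (cases "F p = 0")
      case True
      then show ?thesis
        by (intro always_eventually) simp
    next
      case False
      then obtain k where k: "0 < k" "\<And>q. 1 \<le> q \<Longrightarrow> q < p \<Longrightarrow> k \<le> F q powr (p / q)"
        using integral_powr_lower_bound[OF u0_meas assms(2) int] unfolding F_def by blast
      show ?thesis
        \<comment> \<open>For t \<ge> 1 the power of t is smallest at q = 1, where its exponent is -
          \<beta> (p - 1). One comparison there serves every q, with \<open>k\<close> as common
          lower bound for the norms.\<close>
        using exp_decay_beats_powr[OF c2 k(1), of "3 * F p" "\<beta> * (p - 1)"] eventually_ge_at_top[of 1]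
      proof eventually_elim
        case (elim t)
        show ?case
        proof (intro allI impI)
          fix q assume q: "1 \<le> q \<and> q < p"
          have "p / q \<le> p"
            using q by (simp add: field_simps)
          then have "\<beta> * (p / q - 1) \<le> \<beta> * (p - 1)"
            using \<beta> by (intro mult_left_mono) auto
          then have "t powr (- (\<beta> * (p - 1))) \<le> t powr (- \<beta> * (p / q - 1))"
            using elim by (intro powr_mono) auto
          then have "t powr (- (\<beta> * (p - 1))) * k \<le> t powr (- \<beta> * (p / q - 1)) * F q powr (p / q)"
            using k q by (intro mult_mono) auto
          then show "3 * exp (- c2 * t) * F p \<le> t powr (- \<beta> * (p / q - 1)) * F q powr (p / q)"
            using elim by (simp add: mult_ac)
        qed
      qed
    qed
    then have "\<forall>\<^sub>F t in at_top. (\<forall>q. 1 \<le> q \<and> q < p \<longrightarrow>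
        3 * exp (- c2 * t) * F p \<le> t powr (- \<beta> * (p / q - 1)) * F q powr (p / q))
        \<and> R powr \<alpha> \<le> t \<and> 0 < t"
      \<comment> \<open>The condition \<open>R powr \<alpha> \<le> t\<close> ensures that at least
        one annulus fits between \<open>R\<close> and the scale of t.\<close>
      by (intro eventually_conj eventually_ge_at_top eventually_gt_at_top)
    then obtain t1 where t1: "\<And>t. t1 \<le> t \<Longrightarrow> (\<forall>q. 1 \<le> q \<and> q < p \<longrightarrow>
        3 * exp (- c2 * t) * F p \<le> t powr (- \<beta> * (p / q - 1)) * F q powr (p / q))
        \<and> R powr \<alpha> \<le> t \<and> 0 < t"
      by (auto simp: eventually_at_top_linorder)
    show "\<exists>t0>0. \<forall>t>t0. \<forall>q. 1 \<le> q \<and> q < p \<longrightarrow> u t \<in> Lp p \<and>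
        Lp_norm p (u t) \<le> c q * t powr (- (?N / \<alpha>) * (1 / q - 1 / p)) * Lp_norm q u0"
    proof (intro exI[of _ "max 1 t1"] conjI allI impI)
      show "0 < max 1 t1" by simp
      fix t q :: real
      assume t: "max 1 t1 < t" and q': "1 \<le> q \<and> q < p"
      then have q: "1 \<le> q" "q < p" and p0: "0 < p"
        by auto
      define \<tau> where "\<tau> = t powr (- \<beta> * (p / q - 1))"
      have decay: "3 * exp (- c2 * t) * F p \<le> \<tau> * F q powr (p / q)"
        and t_large: "R powr \<alpha> \<le> t" and t0: "0 < t"
        using t1[of t] t q' unfolding \<tau>_def by auto
      have "(R powr \<alpha>) powr (1 / \<alpha>) \<le> t powr (1 / \<alpha>)"
        using t_large assms by (intro powr_mono2) auto
      then have t_large': "R \<le> t powr (1 / \<alpha>)"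
        using assms by (simp add: powr_powr)
      obtain \<mu> where u_meas [measurable]: "u t \<in> borel_measurable borel"
        and heat: "is_heat_measure J t \<mu>" and u_eq: "AE x in lborel. u t x = conv_measure u0 \<mu> x"
        using sol t0 by (auto simp: is_solution_def)
      have \<mu>: "prob_space \<mu>" "sets \<mu> = sets borel"
        using heat by (auto simp: is_heat_measure_def)
      define M where "M = C * t powr (- \<beta>)"
      have M: "0 < M"
        using C t0 by (simp add: M_def)
      have bound: "emeasure \<mu> E \<le> ennreal M * emeasure lborel E + ennreal (exp (- c2 * t))"
        if "E \<in> sets borel" for E
        unfolding M_def \<beta>_def C_def S_def c2_def c1_def V_def
        using heat_measure_cos_sin[OF heat] J'(6)
        by (intro heat_measure_bound[OF J'(1-4) t0 assms(3,5,6) J'(5) t_large' \<mu> _ _ that]) auto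
      have "(\<integral>\<^sup>+x. ennreal (\<bar>u t x\<bar> powr p) \<partial>lborel) = (\<integral>\<^sup>+x. ennreal (\<bar>conv_measure u0 \<mu> x\<bar> powr p) \<partial>lborel)"
        using u_eq by (intro nn_integral_cong_AE) (auto elim!: eventually_mono)
      also have "\<dots> \<le> ennreal (2 powr p * ((2 * M) powr (p / q - 1) * F q powr (p / q) + 3 * exp (- c2 * t) * F p))"
        unfolding F_def using q
        by (intro conv_measure_powr_bound[OF \<mu> M _ bound u0_meas q] int) auto
      also have "\<dots> \<le> ennreal (2 powr p * (A q * \<tau> * F q powr (p / q)))"
      proof (intro ennreal_leI mult_left_mono)
        have "(2 * M) powr (p / q - 1) = (2 * C) powr (p / q - 1) * \<tau>"
        proof -
          have "2 * M = (2 * C) * t powr (- \<beta>)"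
            by (simp add: M_def)
          also have "\<dots> powr (p / q - 1) = (2 * C) powr (p / q - 1) * (t powr (- \<beta>)) powr (p / q - 1)"
            using C t0 by (intro powr_mult)
          finally show ?thesis
            by (simp only: \<tau>_def powr_powr)
        qed
        then show "(2 * M) powr (p / q - 1) * F q powr (p / q) + 3 * exp (- c2 * t) * F p
            \<le> A q * \<tau> * F q powr (p / q)"
          using decay by (simp add: A_def distrib_right)
      qed simp
      finally have nn: "(\<integral>\<^sup>+x. ennreal (\<bar>u t x\<bar> powr p) \<partial>lborel) \<le> ennreal (2 powr p * (A q * \<tau> * F q powr (p / q)))" .
      have int_u: "integrable lborel (\<lambda>x. \<bar>u t x\<bar> powr p)"
        using nn by (intro integrableI_nonneg) (auto intro: le_less_trans)
      then show "u t \<in> Lp p"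
        by (simp add: Lp_def)
      have rhs0: "0 \<le> 2 powr p * (A q * \<tau> * F q powr (p / q))"
        using A[of q] by (simp add: \<tau>_def)
      have "(LINT x|lborel. \<bar>u t x\<bar> powr p) \<le> 2 powr p * (A q * \<tau> * F q powr (p / q))"
        using nn rhs0 by (subst (asm) nn_integral_eq_integral[OF int_u]) auto
      then have "Lp_norm p (u t) \<le> (2 powr p * (A q * \<tau> * F q powr (p / q))) powr (1 / p)"
        unfolding Lp_norm_def using p0 by (intro powr_mono2) (auto intro: integral_nonneg_AE)
      also have "\<dots> = 2 * (A q powr (1 / p) * \<tau> powr (1 / p) * F q powr (1 / q))"
        using p0 q A[of q] F0[of q] by (simp add: powr_mult powr_powr \<tau>_def)
      also have "\<tau> powr (1 / p) = t powr (- (?N / \<alpha>) * (1 / q - 1 / p))"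
      proof -
        have "- \<beta> * (p / q - 1) * (1 / p) = - (?N / \<alpha>) * (1 / q - 1 / p)"
        proof -
          have "(p / q - 1) * (1 / p) = 1 / q - 1 / p"
            using p0 q by (simp add: field_simps)
          then show ?thesis
            unfolding \<beta>_def mult.assoc by (simp only:)
        qed
        then show ?thesis
          by (simp only: \<tau>_def powr_powr)
      qed
      also have "2 * (A q powr (1 / p) * t powr (- (?N / \<alpha>) * (1 / q - 1 / p)) * F q powr (1 / q))
          = c q * t powr (- (?N / \<alpha>) * (1 / q - 1 / p)) * Lp_norm q u0"
        by (simp add: c_def Lp_norm_def F_def)
      finally show "Lp_norm p (u t) \<le> c q * t powr (- (?N / \<alpha>) * (1 / q - 1 / p)) * Lp_norm q u0" .
    qed
  qed
qed

end
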